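(* The following schemes are provable in $\mathrm{PAI}$: (a) (Apartness) for every $n\in\omega$ and every $\mathcal{L}_{\mathrm{A}}$-formula $\varphi(x_1,\dots,x_n,y)$: $$\forall i\in I\ \forall j\in I\,\big[i<j\to\forall x_1,\dots,x_n<i\,\big(\exists y\,\varphi(\bar x,y)\to\exists y<j\,\varphi(\bar x,y)\big)\big];$$ (b) (Diagonal indiscernibility) for all $n,r\in\omega$ with $r\geq1$ and every $\mathcal{L}_{\mathrm{A}}$-formula $\varphi$ with $n+1+r$ free variables: $$\forall i\in I\ \forall\bar j\in[I]^r\ \forall\bar k\in[I]^r\ \big[(i<j_1)\wedge(i<k_1)\big]\to\big[\forall x_1,\dots,x_n<i\,\big(\varphi(\bar x,i,j_1,\dots,j_r)\leftrightarrow\varphi(\bar x,i,k_1,\dots,k_r)\big)\big].$$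
   Context: $\mathcal{L}_{\mathrm{A}}=\{+,\cdot,\mathrm{S},<,0\}$. $\mathrm{PAI}$ is the theory in $\mathcal{L}_{\mathrm{A}}\cup\{I\}$ ($I$ unary, written $x\in I$) with axioms: (1) $\mathrm{PA}$ together with induction for all formulae of $\mathcal{L}_{\mathrm{A}}\cup\{I\}$; (2) "$I$ is unbounded"; (3) for each $\mathcal{L}_{\mathrm{A}}$-formula $\varphi(v_1,\dots,v_n)$: for all $x_1<\dots<x_n$ in $I$ and $y_1<\dots<y_n$ in $I$, $\varphi(\bar x)\leftrightarrow\varphi(\bar y)$. $\forall\bar j\in[I]^r$ quantifies over increasing $r$-tuples $j_1<\dots<j_r$ of elements of $I$. *)

theory Defs
  imports Main
begin

text \<open>
  First-order logic with equality over \<open>{+, \<cdot>, S, <, 0} \<union> {I}\<close>, in de Bruijn notation.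
\<close>

datatype trm = Var nat | Zero | Succ trm | Plus trm trm | Times trm trm

datatype form =
    Bot
  | Eql trm trm  (infix "\<^bold>=" 55)
  | Less trm trm  (infix "\<^bold><" 55)
  | InI trm
  | Imp form form  (infixr "\<^bold>\<longrightarrow>" 45)
  | Forall form

abbreviation Neg :: "form \<Rightarrow> form" ("\<^bold>\<not> _" [52] 52)
  where "\<^bold>\<not> \<phi> \<equiv> \<phi> \<^bold>\<longrightarrow> Bot"

abbreviation Top :: form
  where "Top \<equiv> \<^bold>\<not> Bot"

abbreviation Conj :: "form \<Rightarrow> form \<Rightarrow> form"  (infixr "\<^bold>\<and>" 50)
  where "\<phi> \<^bold>\<and> \<psi> \<equiv> \<^bold>\<not> (\<phi> \<^bold>\<longrightarrow> \<^bold>\<not> \<psi>)"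

abbreviation Disj :: "form \<Rightarrow> form \<Rightarrow> form"  (infixr "\<^bold>\<or>" 48)
  where "\<phi> \<^bold>\<or> \<psi> \<equiv> \<^bold>\<not> \<phi> \<^bold>\<longrightarrow> \<psi>"

abbreviation Iff :: "form \<Rightarrow> form \<Rightarrow> form"  (infixr "\<^bold>\<longleftrightarrow>" 43)
  where "\<phi> \<^bold>\<longleftrightarrow> \<psi> \<equiv> (\<phi> \<^bold>\<longrightarrow> \<psi>) \<^bold>\<and> (\<psi> \<^bold>\<longrightarrow> \<phi>)"

abbreviation Exists :: "form \<Rightarrow> form"
  where "Exists \<phi> \<equiv> \<^bold>\<not> Forall (\<^bold>\<not> \<phi>)"

definition Conjs :: "form list \<Rightarrow> form"
  where "Conjs \<phi>s = foldr Conj \<phi>s Top"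

definition Foralls :: "nat \<Rightarrow> form \<Rightarrow> form"
  where "Foralls n = Forall ^^ n"

primrec LA_form :: "form \<Rightarrow> bool" where
  "LA_form Bot \<longleftrightarrow> True"
| "LA_form (s \<^bold>= t) \<longleftrightarrow> True"
| "LA_form (s \<^bold>< t) \<longleftrightarrow> True"
| "LA_form (InI t) \<longleftrightarrow> False"
| "LA_form (\<phi> \<^bold>\<longrightarrow> \<psi>) \<longleftrightarrow> LA_form \<phi> \<and> LA_form \<psi>"
| "LA_form (Forall \<phi>) \<longleftrightarrow> LA_form \<phi>"

primrec fv_trm :: "trm \<Rightarrow> nat set" where
  "fv_trm (Var k) = {k}"
| "fv_trm Zero = {}"
| "fv_trm (Succ t) = fv_trm t"
| "fv_trm (Plus s t) = fv_trm s \<union> fv_trm t"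
| "fv_trm (Times s t) = fv_trm s \<union> fv_trm t"

primrec fv :: "form \<Rightarrow> nat set" where
  "fv Bot = {}"
| "fv (s \<^bold>= t) = fv_trm s \<union> fv_trm t"
| "fv (s \<^bold>< t) = fv_trm s \<union> fv_trm t"
| "fv (InI t) = fv_trm t"
| "fv (\<phi> \<^bold>\<longrightarrow> \<psi>) = fv \<phi> \<union> fv \<psi>"
| "fv (Forall \<phi>) = {k. Suc k \<in> fv \<phi>}"

primrec subst_trm :: "(nat \<Rightarrow> trm) \<Rightarrow> trm \<Rightarrow> trm" where
  "subst_trm \<sigma> (Var k) = \<sigma> k"
| "subst_trm \<sigma> Zero = Zero"
| "subst_trm \<sigma> (Succ t) = Succ (subst_trm \<sigma> t)"
| "subst_trm \<sigma> (Plus s t) = Plus (subst_trm \<sigma> s) (subst_trm \<sigma> t)"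
| "subst_trm \<sigma> (Times s t) = Times (subst_trm \<sigma> s) (subst_trm \<sigma> t)"

definition up :: "(nat \<Rightarrow> trm) \<Rightarrow> nat \<Rightarrow> trm"
  where "up \<sigma> = case_nat (Var 0) (\<lambda>k. subst_trm (\<lambda>l. Var (Suc l)) (\<sigma> k))"

primrec subst :: "(nat \<Rightarrow> trm) \<Rightarrow> form \<Rightarrow> form" where
  "subst \<sigma> Bot = Bot"
| "subst \<sigma> (s \<^bold>= t) = (subst_trm \<sigma> s \<^bold>= subst_trm \<sigma> t)"
| "subst \<sigma> (s \<^bold>< t) = (subst_trm \<sigma> s \<^bold>< subst_trm \<sigma> t)"
| "subst \<sigma> (InI t) = InI (subst_trm \<sigma> t)"
| "subst \<sigma> (\<phi> \<^bold>\<longrightarrow> \<psi>) = (subst \<sigma> \<phi> \<^bold>\<longrightarrow> subst \<sigma> \<psi>)"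
| "subst \<sigma> (Forall \<phi>) = Forall (subst (up \<sigma>) \<phi>)"

text \<open>\<open>subst0 t \<phi>\<close> removes the binder level of variable 0, whereas \<open>inst \<phi> ts\<close> is
  \<open>\<phi>(t\<^sub>0, \<dots>, t\<^sub>m)\<close> for a formula \<open>\<phi>\<close> whose free variables are among the first
  \<open>length ts\<close> ones.\<close>

definition lift :: "form \<Rightarrow> form"
  where "lift = subst (\<lambda>k. Var (Suc k))"

definition subst0 :: "trm \<Rightarrow> form \<Rightarrow> form"
  where "subst0 t = subst (case_nat t Var)"

definition inst :: "form \<Rightarrow> trm list \<Rightarrow> form"
  where "inst \<phi> ts = subst (\<lambda>k. if k < length ts then ts ! k else Var k) \<phi>"

text \<open>Classical natural deduction with equality. In \<open>ForallI\<close>, lifting the assumptions frees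
  variable 0, which plays the role of the eigenvariable.\<close>

inductive derives :: "form set \<Rightarrow> form \<Rightarrow> bool"  (infix "\<turnstile>" 40) where
  Assm: "\<phi> \<in> \<Gamma> \<Longrightarrow> \<Gamma> \<turnstile> \<phi>"
| ImpI: "insert \<phi> \<Gamma> \<turnstile> \<psi> \<Longrightarrow> \<Gamma> \<turnstile> \<phi> \<^bold>\<longrightarrow> \<psi>"
| ImpE: "\<Gamma> \<turnstile> \<phi> \<^bold>\<longrightarrow> \<psi> \<Longrightarrow> \<Gamma> \<turnstile> \<phi> \<Longrightarrow> \<Gamma> \<turnstile> \<psi>"
| Contr: "insert (\<^bold>\<not> \<phi>) \<Gamma> \<turnstile> Bot \<Longrightarrow> \<Gamma> \<turnstile> \<phi>"
| ForallI: "lift ` \<Gamma> \<turnstile> \<phi> \<Longrightarrow> \<Gamma> \<turnstile> Forall \<phi>"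
| ForallE: "\<Gamma> \<turnstile> Forall \<phi> \<Longrightarrow> \<Gamma> \<turnstile> subst0 t \<phi>"
| EqlI: "\<Gamma> \<turnstile> t \<^bold>= t"
| EqlE: "\<Gamma> \<turnstile> s \<^bold>= t \<Longrightarrow> \<Gamma> \<turnstile> subst0 s \<phi> \<Longrightarrow> \<Gamma> \<turnstile> subst0 t \<phi>"

text \<open>The variables bound by a block of \<open>n\<close> quantifiers with \<open>m\<close> further binders inside it,
  outermost variable first.\<close>

definition vars :: "nat \<Rightarrow> nat \<Rightarrow> trm list"
  where "vars m n = map Var (rev [m..<m + n])"

definition increasing_in_I :: "trm list \<Rightarrow> form"
  where "increasing_in_I ts = (Conjs (map InI ts) \<^bold>\<and> Conjs (map2 Less ts (tl ts)))"

text \<open>\<open>Forall_I\<close> and \<open>Forall_inc_I r\<close> are the quantifiers \<open>\<forall>i \<in> I\<close> and \<open>\<forall>j \<in> [I]\<^sup>r\<close>;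
  in \<open>Foralls_below n t \<phi>\<close>, that is \<open>\<forall>x\<^sub>1, \<dots>, x\<^sub>n < t. \<phi>\<close>, the term \<open>t\<close> is read inside the block.\<close>

definition Forall_I :: "form \<Rightarrow> form"
  where "Forall_I \<phi> = Forall (InI (Var 0) \<^bold>\<longrightarrow> \<phi>)"

definition Forall_inc_I :: "nat \<Rightarrow> form \<Rightarrow> form"
  where "Forall_inc_I r \<phi> = Foralls r (increasing_in_I (vars 0 r) \<^bold>\<longrightarrow> \<phi>)"

definition Foralls_below :: "nat \<Rightarrow> trm \<Rightarrow> form \<Rightarrow> form"
  where "Foralls_below n t \<phi> = Foralls n (Conjs (map (\<lambda>x. x \<^bold>< t) (vars 0 n)) \<^bold>\<longrightarrow> \<phi>)"

text \<open>The defining axioms of the symbols of Peano arithmetic; in each, the outermost variable is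
  \<open>x\<close> and the next one is \<open>y\<close>.\<close>

definition PA_basic :: "form set" where
  "PA_basic =
    {Foralls 1 (\<^bold>\<not> (Succ (Var 0) \<^bold>= Zero)),
     Foralls 2 (Succ (Var 1) \<^bold>= Succ (Var 0) \<^bold>\<longrightarrow> Var 1 \<^bold>= Var 0),
     Foralls 1 (Plus (Var 0) Zero \<^bold>= Var 0),
     Foralls 2 (Plus (Var 1) (Succ (Var 0)) \<^bold>= Succ (Plus (Var 1) (Var 0))),
     Foralls 1 (Times (Var 0) Zero \<^bold>= Zero),
     Foralls 2 (Times (Var 1) (Succ (Var 0)) \<^bold>= Plus (Times (Var 1) (Var 0)) (Var 1)),
     Foralls 1 (\<^bold>\<not> (Var 0 \<^bold>< Zero)),
     Foralls 2 (Var 1 \<^bold>< Succ (Var 0) \<^bold>\<longleftrightarrow> Var 1 \<^bold>< Var 0 \<^bold>\<or> Var 1 \<^bold>= Var 0)}"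

text \<open>Induction on variable 0 of \<open>\<phi>\<close>; the other free variables \<open>1, \<dots>, m\<close> are parameters.
  There is no restriction to formulae without \<open>I\<close>.\<close>

definition induction_axiom :: "nat \<Rightarrow> form \<Rightarrow> form" where
  "induction_axiom m \<phi> =
    Foralls m
      (subst0 Zero \<phi> \<^bold>\<longrightarrow>
       Forall (\<phi> \<^bold>\<longrightarrow> subst (case_nat (Succ (Var 0)) (\<lambda>k. Var (Suc k))) \<phi>) \<^bold>\<longrightarrow>
       Forall \<phi>)"

definition unbounded_I :: form
  where "unbounded_I = Forall (Exists (Var 1 \<^bold>< Var 0 \<^bold>\<and> InI (Var 0)))"

definition indiscernibility_axiom :: "nat \<Rightarrow> form \<Rightarrow> form" where
  "indiscernibility_axiom n \<phi> =
    Forall_inc_I n (Forall_inc_I n (inst \<phi> (vars n n) \<^bold>\<longleftrightarrow> inst \<phi> (vars 0 n)))"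

definition PAI :: "form set" where
  "PAI = PA_basic
     \<union> {induction_axiom m \<phi> | m \<phi>. fv \<phi> \<subseteq> {..m}}
     \<union> {unbounded_I}
     \<union> {indiscernibility_axiom n \<phi> | n \<phi>. LA_form \<phi> \<and> fv \<phi> \<subseteq> {..<n}}"

text \<open>Inside the block \<open>x\<^sub>1, \<dots>, x\<^sub>n\<close>, the variables \<open>i\<close> and \<open>j\<close> are \<open>n + 1\<close> and \<open>n\<close>;
  the quantifier on \<open>y\<close> raises every index by one.\<close>

definition apartness :: "nat \<Rightarrow> form \<Rightarrow> form" where
  "apartness n \<phi> =
    Forall_I (Forall_I (Var 1 \<^bold>< Var 0 \<^bold>\<longrightarrow>
      Foralls_below n (Var (n + 1))
        (Exists (inst \<phi> (vars 1 n @ [Var 0])) \<^bold>\<longrightarrow>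
         Exists (Var 0 \<^bold>< Var (n + 1) \<^bold>\<and> inst \<phi> (vars 1 n @ [Var 0])))))"

text \<open>Outside the block \<open>x\<^sub>1, \<dots>, x\<^sub>n\<close>, the tuples \<open>j\<close> and \<open>k\<close> are \<open>vars r r\<close> and \<open>vars 0 r\<close>, and
  \<open>i\<close> is the variable \<open>2 * r\<close>.\<close>

definition diagonal_indiscernibility :: "nat \<Rightarrow> nat \<Rightarrow> form \<Rightarrow> form" where
  "diagonal_indiscernibility n r \<phi> =
    Forall_I (Forall_inc_I r (Forall_inc_I r
      (Var (2 * r) \<^bold>< hd (vars r r) \<^bold>\<and> Var (2 * r) \<^bold>< hd (vars 0 r) \<^bold>\<longrightarrow>
       Foralls_below n (Var (n + 2 * r))
         (inst \<phi> (vars 0 n @ Var (n + 2 * r) # vars (n + r) r) \<^bold>\<longleftrightarrow>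
          inst \<phi> (vars 0 n @ Var (n + 2 * r) # vars n r)))))"

end

theory Submission
  imports Defs "HOL-Library.Countable_Set"
begin

text \<open>
  By completeness it suffices to work in a model of PAI. Apartness: by collection some \<open>k \<in> I\<close> above
  \<open>i\<close> bounds witnesses for all \<open>x < i\<close>, and by indiscernibility \<open>k\<close> may be replaced by \<open>j\<close>.
  Diagonal indiscernibility: order the tuples \<open>j\<close> lexicographically by the truth values of
  \<open>\<phi>(x, i, j)\<close> for \<open>x < i\<close>. This comparison is an arithmetical formula in \<open>i, j, k\<close>, so by
  indiscernibility it is monotone in one direction on all \<open>i < j < k\<close>. Induction with \<open>I\<close> shows that
  the truth values are then constant for all tuples beyond some point, and indiscernibility again
  yields that they agree for all \<open>i < j < k\<close>. No coding of sequences is needed.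
\<close>

section \<open>Substitution and derivability\<close>

text \<open>The obstacle is the parameters \<open>x < i\<close>. The indiscernibility axioms speak
  about elements of I only, so for a fixed \<open>x\<close> the truth value of
  \<open>\<phi>(x, i, j)\<close> cannot be carried from one tuple to another. Comparing whole
  families of truth values quantifies the parameters away. The lexicographic order suits this
  purpose because it is definable by nested bounded quantifiers and total: one of the two directions
  holds at some pair of consecutive tuples, hence at all such pairs beyond \<open>i\<close>. A
  single truth value that moves in one direction changes at most once. Hence, as soon as all
  positions below \<open>x\<close> are frozen, position \<open>x\<close> is monotone too and freezes
  in its turn, and a form of collection yields one threshold for all \<open>x < i\<close>. A
  threshold speaks about all later tuples from I; this is where induction for formulae with I
  enters.\<close>

lemma subst_trm_comp:
  "subst_trm \<tau> (subst_trm \<sigma> t) = subst_trm (\<lambda>k. subst_trm \<tau> (\<sigma> k)) t"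
  by (induction t) auto

lemma subst_trm_Var [simp]: "subst_trm Var t = t"
  by (induction t) auto

lemma up_simps [simp]:
  "up \<sigma> 0 = Var 0"
  "up \<sigma> (Suc k) = subst_trm (\<lambda>l. Var (Suc l)) (\<sigma> k)"
  by (auto simp: up_def)

lemma up_Var [simp]: "up Var = Var"
  by (rule ext) (simp add: up_def split: nat.split)

lemma up_comp: "(\<lambda>k. subst_trm (up \<tau>) (up \<sigma> k)) = up (\<lambda>k. subst_trm \<tau> (\<sigma> k))"
  by (rule ext) (auto simp: up_def subst_trm_comp split: nat.split)

lemma subst_comp: "subst \<tau> (subst \<sigma> \<phi>) = subst (\<lambda>k. subst_trm \<tau> (\<sigma> k)) \<phi>"
  by (induction \<phi> arbitrary: \<sigma> \<tau>) (auto simp: subst_trm_comp up_comp)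

lemma subst_Var [simp]: "subst Var \<phi> = \<phi>"
  by (induction \<phi>) auto

lemma subst_trm_cong: "(\<And>k. k \<in> fv_trm t \<Longrightarrow> \<sigma> k = \<tau> k) \<Longrightarrow> subst_trm \<sigma> t = subst_trm \<tau> t"
  by (induction t) auto

lemma subst_cong: "(\<And>k. k \<in> fv \<phi> \<Longrightarrow> \<sigma> k = \<tau> k) \<Longrightarrow> subst \<sigma> \<phi> = subst \<tau> \<phi>"
proof (induction \<phi> arbitrary: \<sigma> \<tau>)
  case (Forall \<phi>)
  have "up \<sigma> k = up \<tau> k" if "k \<in> fv \<phi>" for k
    using that Forall.prems by (cases k) auto
  then have "subst (up \<sigma>) \<phi> = subst (up \<tau>) \<phi>" by (rule Forall.IH)
  then show ?case by simp
next
  case (Imp \<phi> \<psi>)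
  have "subst \<sigma> \<phi> = subst \<tau> \<phi>" "subst \<sigma> \<psi> = subst \<tau> \<psi>"
    using Imp.prems by (auto intro: Imp.IH)
  then show ?case by simp
qed (auto intro!: subst_trm_cong)

lemma finite_fv_trm: "finite (fv_trm t)"
  by (induction t) auto

lemma finite_fv: "finite (fv \<phi>)"
proof (induction \<phi>)
  case (Forall \<phi>)
  have "{k. Suc k \<in> fv \<phi>} = Suc -` fv \<phi>" by auto
  then show ?case using Forall by (simp add: finite_vimageI)
qed (auto simp: finite_fv_trm)

lemma subst_lift: "subst (up \<sigma>) (lift \<phi>) = lift (subst \<sigma> \<phi>)"
  by (simp add: lift_def subst_comp)

lemma subst0_subst_up: "subst0 t (subst (up \<sigma>) \<phi>) = subst (case_nat t \<sigma>) \<phi>"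
proof -
  have "(\<lambda>k. subst_trm (case_nat t Var) (up \<sigma> k)) = case_nat t \<sigma>"
    by (rule ext) (auto simp: up_def subst_trm_comp split: nat.split)
  then show ?thesis by (simp add: subst0_def subst_comp)
qed

lemma subst_subst0: "subst \<sigma> (subst0 t \<phi>) = subst0 (subst_trm \<sigma> t) (subst (up \<sigma>) \<phi>)"
proof -
  have "(\<lambda>k. subst_trm \<sigma> (case_nat t Var k)) = case_nat (subst_trm \<sigma> t) \<sigma>"
    by (rule ext) (auto split: nat.split)
  then show ?thesis by (simp add: subst0_subst_up) (simp add: subst0_def subst_comp)
qed

lemma derives_mono: "\<Gamma> \<turnstile> \<phi> \<Longrightarrow> \<Gamma> \<subseteq> \<Delta> \<Longrightarrow> \<Delta> \<turnstile> \<phi>"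
proof (induction arbitrary: \<Delta> rule: derives.induct)
  case (ForallI \<Gamma> \<phi>)
  then show ?case by (meson derives.ForallI image_mono)
next
  case (ImpI \<phi> \<Gamma> \<psi>)
  then show ?case by (meson derives.ImpI insert_mono)
next
  case (Contr \<phi> \<Gamma>)
  then show ?case by (meson derives.Contr insert_mono)
next
  case (Assm \<phi> \<Gamma>)
  then show ?case by (blast intro: derives.Assm)
next
  case (ImpE \<Gamma> \<phi> \<psi>)
  then show ?case by (blast intro: derives.ImpE)
next
  case (ForallE \<Gamma> \<phi> t)
  then show ?case by (simp add: derives.ForallE)
next
  case (EqlI \<Gamma> t)
  show ?case by (rule derives.EqlI)
next
  case (EqlE \<Gamma> s t \<phi>)
  then show ?case using derives.EqlE[of \<Delta> s t \<phi>] by simp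
qed

lemma derives_subst: "\<Gamma> \<turnstile> \<phi> \<Longrightarrow> subst \<sigma> ` \<Gamma> \<turnstile> subst \<sigma> \<phi>"
proof (induction arbitrary: \<sigma> rule: derives.induct)
  case (ForallI \<Gamma> \<phi>)
  have "lift ` subst \<sigma> ` \<Gamma> \<turnstile> subst (up \<sigma>) \<phi>"
    using ForallI.IH[of "up \<sigma>"] by (simp add: image_image subst_lift)
  then show ?case by (simp add: derives.ForallI)
next
  case (ImpI \<phi> \<Gamma> \<psi>)
  then show ?case by (simp add: derives.ImpI)
next
  case (Contr \<phi> \<Gamma>)
  then show ?case by (simp add: derives.Contr)
next
  case (ForallE \<Gamma> \<phi> t)
  then show ?case by (simp add: subst_subst0 derives.ForallE)
next
  case (EqlE \<Gamma> s t \<phi>)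
  have "subst \<sigma> ` \<Gamma> \<turnstile> subst_trm \<sigma> s \<^bold>= subst_trm \<sigma> t"
    using EqlE.IH(1)[of \<sigma>] by simp
  moreover have "subst \<sigma> ` \<Gamma> \<turnstile> subst0 (subst_trm \<sigma> s) (subst (up \<sigma>) \<phi>)"
    using EqlE.IH(2)[of \<sigma>] by (simp add: subst_subst0)
  ultimately show ?case unfolding subst_subst0 by (rule derives.EqlE)
next
  case (ImpE \<Gamma> \<phi> \<psi>)
  then show ?case using derives.ImpE[of "subst \<sigma> ` \<Gamma>" "subst \<sigma> \<phi>" "subst \<sigma> \<psi>"] by simp
next
  case (Assm \<phi> \<Gamma>)
  then show ?case by (simp add: derives.Assm)
next
  case (EqlI \<Gamma> t)
  show ?case by (simp add: derives.EqlI)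
qed

lemma derives_finite: "\<Gamma> \<turnstile> \<phi> \<Longrightarrow> \<exists>\<Delta>. finite \<Delta> \<and> \<Delta> \<subseteq> \<Gamma> \<and> \<Delta> \<turnstile> \<phi>"
proof (induction rule: derives.induct)
  case (Assm \<phi> \<Gamma>)
  then show ?case by (intro exI[of _ "{\<phi>}"]) (auto intro: derives.Assm)
next
  case (ImpI \<phi> \<Gamma> \<psi>)
  then obtain \<Delta> where "finite \<Delta>" "\<Delta> \<subseteq> insert \<phi> \<Gamma>" "\<Delta> \<turnstile> \<psi>" by blast
  moreover from this have "insert \<phi> (\<Delta> - {\<phi>}) \<turnstile> \<psi>" by (blast intro: derives_mono)
  then have "\<Delta> - {\<phi>} \<turnstile> \<phi> \<^bold>\<longrightarrow> \<psi>" by (rule derives.ImpI)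
  ultimately show ?case by (intro exI[of _ "\<Delta> - {\<phi>}"]) auto
next
  case (Contr \<phi> \<Gamma>)
  then obtain \<Delta> where "finite \<Delta>" "\<Delta> \<subseteq> insert (\<^bold>\<not> \<phi>) \<Gamma>" "\<Delta> \<turnstile> Bot" by blast
  moreover from this have "insert (\<^bold>\<not> \<phi>) (\<Delta> - {\<^bold>\<not> \<phi>}) \<turnstile> Bot" by (blast intro: derives_mono)
  then have "\<Delta> - {\<^bold>\<not> \<phi>} \<turnstile> \<phi>" by (rule derives.Contr)
  ultimately show ?case by (intro exI[of _ "\<Delta> - {\<^bold>\<not> \<phi>}"]) auto
next
  case (ImpE \<Gamma> \<phi> \<psi>)
  then obtain \<Delta> \<Delta>' where "finite \<Delta>" "\<Delta> \<subseteq> \<Gamma>" "\<Delta> \<turnstile> \<phi> \<^bold>\<longrightarrow> \<psi>"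
    "finite \<Delta>'" "\<Delta>' \<subseteq> \<Gamma>" "\<Delta>' \<turnstile> \<phi>" by blast
  moreover from this have "\<Delta> \<union> \<Delta>' \<turnstile> \<psi>"
    by (meson derives.ImpE derives_mono sup_ge1 sup_ge2)
  ultimately show ?case by (intro exI[of _ "\<Delta> \<union> \<Delta>'"]) auto
next
  case (EqlE \<Gamma> s t \<phi>)
  then obtain \<Delta> \<Delta>' where "finite \<Delta>" "\<Delta> \<subseteq> \<Gamma>" "\<Delta> \<turnstile> s \<^bold>= t"
    "finite \<Delta>'" "\<Delta>' \<subseteq> \<Gamma>" "\<Delta>' \<turnstile> subst0 s \<phi>" by blast
  moreover from this have "\<Delta> \<union> \<Delta>' \<turnstile> s \<^bold>= t" "\<Delta> \<union> \<Delta>' \<turnstile> subst0 s \<phi>"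
    by (meson derives_mono sup_ge1 sup_ge2)+
  then have "\<Delta> \<union> \<Delta>' \<turnstile> subst0 t \<phi>" by (rule derives.EqlE)
  ultimately show ?case by (intro exI[of _ "\<Delta> \<union> \<Delta>'"]) auto
next
  case (ForallI \<Gamma> \<phi>)
  then obtain \<Delta> where "finite \<Delta>" "\<Delta> \<subseteq> lift ` \<Gamma>" and \<phi>: "\<Delta> \<turnstile> \<phi>" by blast
  then obtain \<Delta>' where "finite \<Delta>'" "\<Delta>' \<subseteq> \<Gamma>" "\<Delta> = lift ` \<Delta>'"
    by (meson finite_subset_image)
  moreover from this have "\<Delta>' \<turnstile> Forall \<phi>" using \<phi> by (simp add: derives.ForallI)
  ultimately show ?case by blast
next
  case (ForallE \<Gamma> \<phi> t)
  then obtain \<Delta> where "finite \<Delta>" "\<Delta> \<subseteq> \<Gamma>" "\<Delta> \<turnstile> Forall \<phi>" by blast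
  moreover from this have "\<Delta> \<turnstile> subst0 t \<phi>" by (simp add: derives.ForallE)
  ultimately show ?case by blast
next
  case (EqlI \<Gamma> t)
  show ?case by (intro exI[of _ "{}"]) (simp add: derives.EqlI)
qed

lemma derives_cut: "\<Gamma> \<turnstile> \<phi> \<Longrightarrow> insert \<phi> \<Gamma> \<turnstile> \<psi> \<Longrightarrow> \<Gamma> \<turnstile> \<psi>"
  by (meson ImpE ImpI)

text \<open>The substitution that sends \<open>k\<close> to variable 0 and lifts every other
  variable turns a fresh \<open>k\<close> into the eigenvariable of \<open>ForallI\<close>. Free
  variables can thus serve as Henkin constants, and the theory need not be shifted at each new
  witness.\<close>

lemma ForallI_fresh:
  assumes "\<Gamma> \<turnstile> subst0 (Var k) \<psi>" "\<And>\<gamma>. \<gamma> \<in> \<Gamma> \<Longrightarrow> k \<notin> fv \<gamma>" "k \<notin> fv (Forall \<psi>)"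
  shows "\<Gamma> \<turnstile> Forall \<psi>"
proof -
  define \<sigma> where "\<sigma> l = (if l = k then Var 0 else Var (Suc l))" for l
  have *: "subst \<sigma> \<gamma> = lift \<gamma>" if "\<gamma> \<in> \<Gamma>" for \<gamma>
    unfolding lift_def using assms(2)[OF that] by (intro subst_cong) (auto simp: \<sigma>_def)
  have "subst \<sigma> (subst0 (Var k) \<psi>) = subst Var \<psi>"
    unfolding subst0_def subst_comp using assms(3)
    by (intro subst_cong) (auto simp: \<sigma>_def split: nat.split)
  moreover have "subst \<sigma> ` \<Gamma> = lift ` \<Gamma>"
    using * by (rule image_cong[OF refl])
  ultimately have "lift ` \<Gamma> \<turnstile> \<psi>"
    using derives_subst[OF assms(1), of \<sigma>] by simp
  then show ?thesis by (rule ForallI)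
qed

section \<open>Completeness\<close>

datatype 'a model = Model
  (zeroM: 'a) (succM: "'a \<Rightarrow> 'a") (plusM: "'a \<Rightarrow> 'a \<Rightarrow> 'a") (timesM: "'a \<Rightarrow> 'a \<Rightarrow> 'a")
  (lessM: "'a \<Rightarrow> 'a \<Rightarrow> bool") (inM: "'a \<Rightarrow> bool")

primrec val :: "'a model \<Rightarrow> (nat \<Rightarrow> 'a) \<Rightarrow> trm \<Rightarrow> 'a" where
  "val M e (Var k) = e k"
| "val M e Zero = zeroM M"
| "val M e (Succ t) = succM M (val M e t)"
| "val M e (Plus s t) = plusM M (val M e s) (val M e t)"
| "val M e (Times s t) = timesM M (val M e s) (val M e t)"

primrec sat :: "'a model \<Rightarrow> (nat \<Rightarrow> 'a) \<Rightarrow> form \<Rightarrow> bool" where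
  "sat M e Bot \<longleftrightarrow> False"
| "sat M e (s \<^bold>= t) \<longleftrightarrow> val M e s = val M e t"
| "sat M e (s \<^bold>< t) \<longleftrightarrow> lessM M (val M e s) (val M e t)"
| "sat M e (InI t) \<longleftrightarrow> inM M (val M e t)"
| "sat M e (\<phi> \<^bold>\<longrightarrow> \<psi>) \<longleftrightarrow> (sat M e \<phi> \<longrightarrow> sat M e \<psi>)"
| "sat M e (Forall \<phi>) \<longleftrightarrow> (\<forall>x. sat M (case_nat x e) \<phi>)"

definition "consistent \<Gamma> \<longleftrightarrow> \<not> \<Gamma> \<turnstile> Bot"

text \<open>One condition per formula, joining the decision of \<open>\<phi>\<close> with a term
  that witnesses the failure of a universal formula, so that an enumeration can treat formulae one
  at a time.\<close>

definition henkin :: "form set \<Rightarrow> form \<Rightarrow> bool" where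
  "henkin \<Gamma> \<phi> \<longleftrightarrow> \<phi> \<in> \<Gamma> \<or>
    (\<^bold>\<not> \<phi>) \<in> \<Gamma> \<and> (\<forall>\<psi>. \<phi> = Forall \<psi> \<longrightarrow> (\<exists>t. (\<^bold>\<not> subst0 t \<psi>) \<in> \<Gamma>))"

text \<open>If \<open>\<phi>\<close> cannot be added, its negation can. For a universal
  \<open>\<phi>\<close> a fresh variable can then be declared a counterexample, since otherwise
  \<open>ForallI_fresh\<close> would derive \<open>\<phi>\<close>. The finiteness condition is
  carried along so that fresh variables remain available.\<close>

lemma henkin_step:
  assumes "consistent \<Gamma>" "finite (\<Union> (fv ` \<Gamma>))"
  shows "\<exists>\<Delta>. \<Gamma> \<subseteq> \<Delta> \<and> consistent \<Delta> \<and> finite (\<Union> (fv ` \<Delta>)) \<and> henkin \<Delta> \<phi>"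
proof (cases "consistent (insert \<phi> \<Gamma>)")
  case True
  then show ?thesis using assms finite_fv
    by (intro exI[of _ "insert \<phi> \<Gamma>"]) (auto simp: henkin_def)
next
  case False
  then have neg: "\<Gamma> \<turnstile> \<^bold>\<not> \<phi>" by (simp add: consistent_def ImpI)
  then have cons: "consistent (insert (\<^bold>\<not> \<phi>) \<Gamma>)"
    using assms(1) derives_cut unfolding consistent_def by blast
  show ?thesis
  proof (cases "\<exists>\<psi>. \<phi> = Forall \<psi>")
    case False
    then show ?thesis using assms cons finite_fv
      by (intro exI[of _ "insert (\<^bold>\<not> \<phi>) \<Gamma>"]) (auto simp: henkin_def)
  next
    case True
    then obtain \<psi> where \<psi>: "\<phi> = Forall \<psi>" by blast
    let ?\<Gamma> = "insert (\<^bold>\<not> \<phi>) \<Gamma>"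
    have fin: "finite (\<Union> (fv ` ?\<Gamma>))" using assms(2) finite_fv by auto
    then obtain k where k: "k \<notin> \<Union> (fv ` ?\<Gamma>)"
      using ex_new_if_finite infinite_UNIV_nat by blast
    let ?\<Delta> = "insert (\<^bold>\<not> subst0 (Var k) \<psi>) ?\<Gamma>"
    have "consistent ?\<Delta>"
    proof (rule ccontr)
      assume "\<not> consistent ?\<Delta>"
      then have "?\<Gamma> \<turnstile> subst0 (Var k) \<psi>" by (simp add: consistent_def Contr)
      then have "?\<Gamma> \<turnstile> Forall \<psi>" using k by (intro ForallI_fresh) (auto simp: \<psi>)
      then have "?\<Gamma> \<turnstile> Bot" by (metis ImpE Assm insertI1 \<psi>)
      then show False using cons by (simp add: consistent_def)
    qed
    moreover have "finite (\<Union> (fv ` ?\<Delta>))" using fin finite_fv by auto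
    ultimately show ?thesis
      by (intro exI[of _ ?\<Delta>]) (auto simp: henkin_def \<psi>)
  qed
qed

instance trm :: countable by countable_datatype

instance form :: countable by countable_datatype

text \<open>Stage \<open>n\<close> settles the formula with number \<open>n\<close>. A derivation
  uses finitely many assumptions, so an inconsistency of the union would already appear at some
  stage.\<close>

lemma henkin_extension:
  assumes "consistent \<Gamma>" "finite (\<Union> (fv ` \<Gamma>))"
  obtains H where "\<Gamma> \<subseteq> H" "consistent H" "\<And>\<phi>. henkin H \<phi>"
proof -
  let ?good = "\<lambda>\<Delta>. consistent \<Delta> \<and> finite (\<Union> (fv ` \<Delta>)) \<and> \<Gamma> \<subseteq> \<Delta>"
  have "\<exists>f. \<forall>n. ?good (f n) \<and> (f n \<subseteq> f (Suc n) \<and> henkin (f (Suc n)) (from_nat n))"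
  proof (rule dependent_nat_choice)
    show "\<exists>\<Delta>. ?good \<Delta>" using assms by blast
  next
    fix \<Delta> n assume "?good \<Delta>"
    then show "\<exists>\<Delta>'. ?good \<Delta>' \<and> (\<Delta> \<subseteq> \<Delta>' \<and> henkin \<Delta>' (from_nat n))"
      using henkin_step[of \<Delta> "from_nat n"] by blast
  qed
  then obtain f where good: "\<And>n. ?good (f n)" and inc: "\<And>n. f n \<subseteq> f (Suc n)"
    and hen: "\<And>n. henkin (f (Suc n)) (from_nat n)" by blast
  have mono: "m \<le> n \<Longrightarrow> f m \<subseteq> f n" for m n using inc by (rule lift_Suc_mono_le)
  define H where "H = (\<Union>n. f n)"
  have fin: "\<exists>n. \<Delta> \<subseteq> f n" if "finite \<Delta>" "\<Delta> \<subseteq> H" for \<Delta>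
    using that
  proof (induction \<Delta> rule: finite_induct)
    case (insert \<gamma> \<Delta>)
    then obtain m n where "\<gamma> \<in> f m" "\<Delta> \<subseteq> f n" by (auto simp: H_def)
    then show ?case using mono[of m "max m n"] mono[of n "max m n"] by auto
  qed auto
  show ?thesis
  proof
    show "\<Gamma> \<subseteq> H" using good by (auto simp: H_def)
    show "consistent H"
      unfolding consistent_def
      using derives_finite[of H Bot] fin good derives_mono unfolding consistent_def by metis
    fix \<phi>
    have "henkin (f (Suc (to_nat \<phi>))) \<phi>" using hen[of "to_nat \<phi>"] by simp
    moreover have "f (Suc (to_nat \<phi>)) \<subseteq> H" by (auto simp: H_def)
    ultimately show "henkin H \<phi>" unfolding henkin_def by blast
  qed
qed

section \<open>The term model of a Henkin theory\<close>

primrec numeral_trm :: "nat \<Rightarrow> trm" where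
  "numeral_trm 0 = Zero"
| "numeral_trm (Suc n) = Succ (numeral_trm n)"

locale henkin_theory =
  fixes H :: "form set"
  assumes consistent: "consistent H" and henkin: "henkin H \<phi>"
begin

lemma derives_iff: "H \<turnstile> \<phi> \<longleftrightarrow> \<phi> \<in> H"
  using consistent henkin[of \<phi>] unfolding consistent_def henkin_def by (meson Assm ImpE)

lemma Bot_notin: "Bot \<notin> H"
  using consistent unfolding consistent_def derives_iff .

lemma Imp_iff: "(\<phi> \<^bold>\<longrightarrow> \<psi>) \<in> H \<longleftrightarrow> (\<phi> \<in> H \<longrightarrow> \<psi> \<in> H)"
proof
  assume "(\<phi> \<^bold>\<longrightarrow> \<psi>) \<in> H"
  then show "\<phi> \<in> H \<longrightarrow> \<psi> \<in> H" using ImpE derives_iff by blast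
next
  assume *: "\<phi> \<in> H \<longrightarrow> \<psi> \<in> H"
  show "(\<phi> \<^bold>\<longrightarrow> \<psi>) \<in> H"
  proof (cases "\<phi> \<in> H")
    case True
    then show ?thesis using * by (meson Assm ImpI derives_iff insertI2)
  next
    case False
    then have neg: "(\<^bold>\<not> \<phi>) \<in> H" using henkin[of \<phi>] by (simp add: henkin_def)
    have "insert (\<^bold>\<not> \<psi>) (insert \<phi> H) \<turnstile> Bot"
      by (rule ImpE[of _ \<phi>]) (use neg in \<open>auto intro: Assm\<close>)
    then show ?thesis using Contr ImpI derives_iff by blast
  qed
qed

lemma Forall_iff: "Forall \<phi> \<in> H \<longleftrightarrow> (\<forall>t. subst0 t \<phi> \<in> H)"
  using henkin[of "Forall \<phi>"] ForallE[of H \<phi>] Imp_iff Bot_notin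
  unfolding henkin_def derives_iff by blast

lemma Eql_subst: "(s \<^bold>= t) \<in> H \<Longrightarrow> subst0 s \<phi> \<in> H \<Longrightarrow> subst0 t \<phi> \<in> H"
  using EqlE derives_iff by blast

lemma Eql_refl: "(t \<^bold>= t) \<in> H"
  using EqlI derives_iff by blast

text \<open>In the Leibniz contexts below, variable 0 marks the place of replacement; a shifted term
  comes back as the original term when something is substituted for it.\<close>

abbreviation shift :: "trm \<Rightarrow> trm" where "shift \<equiv> subst_trm (\<lambda>l. Var (Suc l))"

lemma Eql_sym: "(s \<^bold>= t) \<in> H \<Longrightarrow> (t \<^bold>= s) \<in> H"
  using Eql_subst[of s t "Var 0 \<^bold>= shift s"] Eql_refl
  by (simp add: subst0_def subst_trm_comp)

lemma Eql_trans: "(s \<^bold>= t) \<in> H \<Longrightarrow> (t \<^bold>= u) \<in> H \<Longrightarrow> (s \<^bold>= u) \<in> H"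
  using Eql_subst[of t u "shift s \<^bold>= Var 0"] by (simp add: subst0_def subst_trm_comp)

lemma Eql_Succ: "(s \<^bold>= t) \<in> H \<Longrightarrow> (Succ s \<^bold>= Succ t) \<in> H"
  using Eql_subst[of s t "shift (Succ s) \<^bold>= Succ (Var 0)"] Eql_refl
  by (simp add: subst0_def subst_trm_comp)

lemma Eql_Plus:
  assumes "(s \<^bold>= t) \<in> H" "(s' \<^bold>= t') \<in> H"
  shows "(Plus s s' \<^bold>= Plus t t') \<in> H"
  using Eql_subst[OF assms(1), of "shift (Plus s s') \<^bold>= Plus (Var 0) (shift s')"]
    Eql_subst[OF assms(2), of "shift (Plus s s') \<^bold>= Plus (shift t) (Var 0)"] Eql_refl
  by (simp add: subst0_def subst_trm_comp)

lemma Eql_Times: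
  assumes "(s \<^bold>= t) \<in> H" "(s' \<^bold>= t') \<in> H"
  shows "(Times s s' \<^bold>= Times t t') \<in> H"
  using Eql_subst[OF assms(1), of "shift (Times s s') \<^bold>= Times (Var 0) (shift s')"]
    Eql_subst[OF assms(2), of "shift (Times s s') \<^bold>= Times (shift t) (Var 0)"] Eql_refl
  by (simp add: subst0_def subst_trm_comp)

lemma Eql_Less:
  assumes "(s \<^bold>= t) \<in> H" "(s' \<^bold>= t') \<in> H" "(s \<^bold>< s') \<in> H"
  shows "(t \<^bold>< t') \<in> H"
  using Eql_subst[OF assms(1), of "Var 0 \<^bold>< shift s'"]
    Eql_subst[OF assms(2), of "shift t \<^bold>< Var 0"] assms(3)
  by (simp add: subst0_def subst_trm_comp)

lemma Eql_InI: "(s \<^bold>= t) \<in> H \<Longrightarrow> InI s \<in> H \<Longrightarrow> InI t \<in> H"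
  using Eql_subst[of s t "InI (Var 0)"] by (simp add: subst0_def)

text \<open>The quotient of the term model is countably infinite as soon as the numerals are distinct,
  so its domain can be taken to be \<^typ>\<open>nat\<close>.\<close>

lemma ex_model:
  assumes "\<And>m n. (numeral_trm m \<^bold>= numeral_trm n) \<in> H \<Longrightarrow> m = n"
  shows "\<exists>(M :: nat model) e. \<forall>\<phi>. sat M e \<phi> \<longleftrightarrow> \<phi> \<in> H"
proof -
  define C where "C t = {s. (t \<^bold>= s) \<in> H}" for t
  have C_eq: "C s = C t \<longleftrightarrow> (s \<^bold>= t) \<in> H" for s t
    unfolding C_def using Eql_refl Eql_sym Eql_trans by blast
  have "inj (\<lambda>n. C (numeral_trm n))"
    using assms by (auto simp: inj_def C_eq)
  then have "infinite (range (\<lambda>n. C (numeral_trm n)))"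
    by (simp add: finite_image_iff)
  then have "infinite (range C)"
    by (rule contrapos_nn) (auto elim: finite_subset[rotated])
  moreover have "countable (range C)" by simp
  ultimately obtain f where f: "bij_betw f (range C) (UNIV :: nat set)"
    by (metis to_nat_on_infinite)
  define c where "c t = f (C t)" for t
  have c_eq: "c s = c t \<longleftrightarrow> (s \<^bold>= t) \<in> H" for s t
    unfolding c_def C_eq[symmetric] using f by (auto simp: bij_betw_def inj_on_def)
  have c_surj: "\<exists>t. x = c t" for x
    using f unfolding c_def bij_betw_def by (metis UNIV_I imageE)
  \<comment> \<open>\<open>d\<close> picks a representative term for each element; the congruence
    lemmas make the operations of \<open>M\<close> independent of the choice.\<close>
  define d where "d = inv c"
  have cd: "c (d x) = x" for x
    unfolding d_def using c_surj by (metis f_inv_into_f rangeI)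
  then have dc: "(d (c t) \<^bold>= t) \<in> H" "(t \<^bold>= d (c t)) \<in> H" for t
    by (simp_all flip: c_eq)
  define M where "M = Model (c Zero) (\<lambda>x. c (Succ (d x))) (\<lambda>x y. c (Plus (d x) (d y)))
    (\<lambda>x y. c (Times (d x) (d y))) (\<lambda>x y. (d x \<^bold>< d y) \<in> H) (\<lambda>x. InI (d x) \<in> H)"
  have val: "val M (\<lambda>k. c (\<sigma> k)) t = c (subst_trm \<sigma> t)" for \<sigma> t
    by (induction t) (auto simp: M_def c_eq intro: Eql_Succ Eql_Plus Eql_Times dc)
  \<comment> \<open>The truth lemma is stated for all \<open>\<sigma>\<close> because passing a
    quantifier turns \<open>\<sigma>\<close> into \<open>case_nat t \<sigma>\<close>; the identity
    substitution gives the claim.\<close>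
  have "sat M (\<lambda>k. c (\<sigma> k)) \<phi> \<longleftrightarrow> subst \<sigma> \<phi> \<in> H" for \<sigma> \<phi>
  proof (induction \<phi> arbitrary: \<sigma>)
    case (Less s t)
    then show ?case
      by (simp add: val) (auto simp: M_def intro: Eql_Less dc)
  next
    case (InI t)
    then show ?case
      by (simp add: val) (auto simp: M_def intro: Eql_InI dc)
  next
    case (Forall \<phi>)
    have "sat M (case_nat (c t) (\<lambda>k. c (\<sigma> k))) \<phi> \<longleftrightarrow> subst (case_nat t \<sigma>) \<phi> \<in> H" for t
    proof -
      have "case_nat (c t) (\<lambda>k. c (\<sigma> k)) = (\<lambda>k. c (case_nat t \<sigma> k))"
        by (rule ext) (simp split: nat.split)
      then show ?thesis using Forall.IH by simp
    qed
    then show ?case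
      using c_surj by (simp add: Forall_iff subst0_subst_up) metis
  qed (auto simp: val c_eq Bot_notin Imp_iff)
  from this[of Var] show ?thesis by auto
qed

end

text \<open>Models on \<open>nat\<close> suffice because provably distinct numerals make the term
  model countably infinite. Closed axioms leave all but finitely many variables available as Henkin
  constants.\<close>

theorem completeness:
  assumes "\<And>\<gamma>. \<gamma> \<in> \<Gamma> \<Longrightarrow> fv \<gamma> = {}"
    and numerals: "\<And>m n. m < n \<Longrightarrow> \<Gamma> \<turnstile> \<^bold>\<not> (numeral_trm n \<^bold>= numeral_trm m)"
    and valid: "\<And>(M :: nat model) e. (\<And>\<gamma>. \<gamma> \<in> \<Gamma> \<Longrightarrow> sat M e \<gamma>) \<Longrightarrow> sat M e \<phi>"
  shows "\<Gamma> \<turnstile> \<phi>"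
proof (rule ccontr)
  assume "\<not> \<Gamma> \<turnstile> \<phi>"
  then have "consistent (insert (\<^bold>\<not> \<phi>) \<Gamma>)"
    unfolding consistent_def using Contr by blast
  moreover have "\<Union> (fv ` insert (\<^bold>\<not> \<phi>) \<Gamma>) = fv \<phi>"
    using assms(1) by auto
  ultimately obtain H where sub: "insert (\<^bold>\<not> \<phi>) \<Gamma> \<subseteq> H"
    and H: "consistent H" "\<And>\<phi>. henkin H \<phi>"
    using henkin_extension[of "insert (\<^bold>\<not> \<phi>) \<Gamma>"] finite_fv by metis
  interpret henkin_theory H by standard (fact H)+
  have ne: "(numeral_trm n \<^bold>= numeral_trm m) \<notin> H" if "m < n" for m n
    using derives_mono[OF numerals[OF that], of H] sub derives_iff Imp_iff Bot_notin by blast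
  have "m = n" if "(numeral_trm m \<^bold>= numeral_trm n) \<in> H" for m n
    using ne[of n m] ne[of m n] that Eql_sym[OF that] by (cases m n rule: linorder_cases) auto
  then obtain M :: "nat model" and e where M: "\<And>\<phi>. sat M e \<phi> \<longleftrightarrow> \<phi> \<in> H"
    using ex_model by blast
  then have "sat M e \<phi>" using sub valid[of M e] by blast
  moreover have "sat M e (\<^bold>\<not> \<phi>)" unfolding M using sub by blast
  ultimately show False by simp
qed

section \<open>Semantics of the defined operations\<close>

lemma val_subst: "val M e (subst_trm \<sigma> t) = val M (\<lambda>k. val M e (\<sigma> k)) t"
  by (induction t) auto

lemma sat_subst: "sat M e (subst \<sigma> \<phi>) \<longleftrightarrow> sat M (\<lambda>k. val M e (\<sigma> k)) \<phi>"
proof (induction \<phi> arbitrary: e \<sigma>)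
  case (Forall \<phi>)
  have "(\<lambda>k. val M (case_nat x e) (up \<sigma> k)) = case_nat x (\<lambda>k. val M e (\<sigma> k))" for x
    by (rule ext) (simp add: up_def val_subst split: nat.split)
  then show ?case using Forall.IH by simp
qed (auto simp: val_subst)

lemma sat_subst0: "sat M e (subst0 t \<phi>) \<longleftrightarrow> sat M (case_nat (val M e t) e) \<phi>"
proof -
  have "(\<lambda>k. val M e (case_nat t Var k)) = case_nat (val M e t) e"
    by (rule ext) (simp split: nat.split)
  then show ?thesis by (simp add: subst0_def sat_subst)
qed

lemma val_cong: "(\<And>k. k \<in> fv_trm t \<Longrightarrow> e k = e' k) \<Longrightarrow> val M e t = val M e' t"
  by (induction t) auto

lemma sat_cong: "(\<And>k. k \<in> fv \<phi> \<Longrightarrow> e k = e' k) \<Longrightarrow> sat M e \<phi> \<longleftrightarrow> sat M e' \<phi>"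
proof (induction \<phi> arbitrary: e e')
  case (Forall \<phi>)
  have "sat M (case_nat x e) \<phi> \<longleftrightarrow> sat M (case_nat x e') \<phi>" for x
    using Forall.prems by (intro Forall.IH) (auto split: nat.split)
  then show ?case by simp
next
  case (Imp \<phi> \<psi>)
  have "sat M e \<phi> \<longleftrightarrow> sat M e' \<phi>" "sat M e \<psi> \<longleftrightarrow> sat M e' \<psi>"
    using Imp.prems by (auto intro!: Imp.IH)
  then show ?case by simp
next
  case (Eql s t)
  then show ?case using val_cong[of s e e' M] val_cong[of t e e' M] by auto
next
  case (Less s t)
  then show ?case using val_cong[of s e e' M] val_cong[of t e e' M] by auto
next
  case (InI t)
  then show ?case using val_cong[of t e e' M] by auto
qed auto

lemma fv_subst_trm: "fv_trm (subst_trm \<sigma> t) = (\<Union>k\<in>fv_trm t. fv_trm (\<sigma> k))"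
  by (induction t) auto

lemma fv_subst: "fv (subst \<sigma> \<phi>) = (\<Union>k\<in>fv \<phi>. fv_trm (\<sigma> k))"
proof (induction \<phi> arbitrary: \<sigma>)
  case (Forall \<phi>)
  have "Suc l \<in> fv_trm (up \<sigma> k) \<longleftrightarrow> (\<exists>k'. k = Suc k' \<and> l \<in> fv_trm (\<sigma> k'))" for k l
    by (cases k) (auto simp: fv_subst_trm)
  then show ?case using Forall.IH by auto
qed (auto simp: fv_subst_trm)

lemma LA_subst [simp]: "LA_form (subst \<sigma> \<phi>) = LA_form \<phi>"
  by (induction \<phi> arbitrary: \<sigma>) auto

section \<open>Tuples as assignments\<close>

text \<open>An assignment is treated as a stack with the innermost variable on top. A quantifier
  block with values \<open>xs\<close>, outermost first, therefore leads to
  \<open>env (rev xs) e\<close>.\<close>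

primrec env :: "'a list \<Rightarrow> (nat \<Rightarrow> 'a) \<Rightarrow> nat \<Rightarrow> 'a" where
  "env [] e = e"
| "env (x # xs) e = case_nat x (env xs e)"

lemma env_append [simp]: "env (xs @ ys) e = env xs (env ys e)"
  by (induction xs) auto

lemma env_eq: "env xs e k = (if k < length xs then xs ! k else e (k - length xs))"
  by (induction xs arbitrary: k) (auto split: nat.split)

text \<open>Any assignment is a block of \<open>m\<close> values on top of a shifted one, so a
  universal closure can be instantiated to reach any given assignment.\<close>

lemma env_drop: "env (map e [0..<m]) (\<lambda>k. e (k + m)) = e"
  by (rule ext) (auto simp: env_eq)

lemma map_env: "map (env xs e) [0..<length xs] = xs"
  by (rule nth_equalityI) (auto simp: env_eq)

lemma map_env_rev:
  "map (env zs (env (rev xs) e)) (rev [length zs..<length zs + length xs]) = xs"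
proof -
  have "map (env zs (env (rev xs) e)) [length zs..<length zs + length xs] = rev xs"
    by (rule nth_equalityI) (auto simp: env_eq)
  then show ?thesis by (metis rev_map rev_rev_ident)
qed

lemma map_val_vars:
  "length xs = n \<Longrightarrow> map (val M (env (rev xs) e)) (vars 0 n) = xs"
  "length zs = m \<Longrightarrow> length xs = n \<Longrightarrow> map (val M (env zs (env (rev xs) e))) (vars m n) = xs"
  using map_env_rev[of "[]" xs e] map_env_rev[of zs xs e] by (auto simp: vars_def comp_def)

lemma length_vars [simp]: "length (vars m n) = n"
  by (simp add: vars_def)

lemma sat_Foralls:
  "sat M e (Foralls n \<phi>) \<longleftrightarrow> (\<forall>xs. length xs = n \<longrightarrow> sat M (env xs e) \<phi>)"
proof (induction n arbitrary: e)
  case 0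
  then show ?case by (simp add: Foralls_def)
next
  case (Suc n)
  have "sat M e (Foralls (Suc n) \<phi>) \<longleftrightarrow> (\<forall>x. sat M (case_nat x e) (Foralls n \<phi>))"
    by (simp add: Foralls_def)
  also have "\<dots> \<longleftrightarrow> (\<forall>x xs. length xs = n \<longrightarrow> sat M (env (xs @ [x]) e) \<phi>)"
    by (simp add: Suc.IH)
  also have "\<dots> \<longleftrightarrow> (\<forall>xs. length xs = Suc n \<longrightarrow> sat M (env xs e) \<phi>)"
    by (metis length_Suc_conv_rev)
  finally show ?case .
qed

lemma sat_Foralls_rev:
  "sat M e (Foralls n \<phi>) \<longleftrightarrow> (\<forall>xs. length xs = n \<longrightarrow> sat M (env (rev xs) e) \<phi>)"
  unfolding sat_Foralls by (metis length_rev rev_rev_ident)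

lemma fv_Foralls: "fv (Foralls n \<phi>) = {k. k + n \<in> fv \<phi>}"
  by (induction n) (auto simp: Foralls_def)

lemma LA_Foralls [simp]: "LA_form (Foralls n \<phi>) = LA_form \<phi>"
  by (induction n) (auto simp: Foralls_def)

lemma sat_Conjs: "sat M e (Conjs \<phi>s) \<longleftrightarrow> (\<forall>\<phi>\<in>set \<phi>s. sat M e \<phi>)"
  by (induction \<phi>s) (auto simp: Conjs_def)

lemma fv_Conjs: "fv (Conjs \<phi>s) = \<Union> (fv ` set \<phi>s)"
  by (induction \<phi>s) (auto simp: Conjs_def)

lemma LA_Conjs: "LA_form (Conjs \<phi>s) \<longleftrightarrow> (\<forall>\<phi>\<in>set \<phi>s. LA_form \<phi>)"
  by (induction \<phi>s) (auto simp: Conjs_def)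

text \<open>The tuple covers all free variables of \<open>\<phi>\<close>, which leaves
  \<open>e'\<close> arbitrary. Taking it constant makes instances from different contexts
  comparable.\<close>

lemma sat_inst:
  assumes "fv \<phi> \<subseteq> {..<length ts}"
  shows "sat M e (inst \<phi> ts) \<longleftrightarrow> sat M (env (map (val M e) ts) e') \<phi>"
  unfolding inst_def sat_subst using assms by (intro sat_cong) (auto simp: env_eq)

lemma sat_Foralls_below:
  "sat M e (Foralls_below n t \<phi>) \<longleftrightarrow>
    (\<forall>xs. length xs = n \<longrightarrow> (\<forall>x\<in>set xs. lessM M x (val M (env (rev xs) e) t)) \<longrightarrow>
      sat M (env (rev xs) e) \<phi>)"
proof -
  have "(\<forall>x\<in>set (vars 0 n). lessM M (val M (env (rev xs) e) x) v) \<longleftrightarrow> (\<forall>x\<in>set xs. lessM M x v)"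
    if "length xs = n" for xs v
  proof -
    have "set xs = val M (env (rev xs) e) ` set (vars 0 n)"
      using arg_cong[OF map_val_vars(1)[OF that, of M e], of set] by simp
    then show ?thesis by simp
  qed
  then show ?thesis
    by (simp add: Foralls_below_def sat_Foralls_rev sat_Conjs)
qed

text \<open>\<open>increasing_in_I\<close> compares neighbours only; transitivity extends this to
  all pairs.\<close>

lemma sorted_wrt_iff_zip:
  assumes "transp R"
  shows "(\<forall>(x, y)\<in>set (zip xs (tl xs)). R x y) \<longleftrightarrow> sorted_wrt R xs"
  by (induction xs rule: induct_list012) (auto simp: sorted_wrt2[OF assms] sorted_wrt1 simp del: sorted_wrt.simps(2))

lemma closed_PAI:
  assumes "\<gamma> \<in> PAI"
  shows "fv \<gamma> = {}"
proof -
  have vars: "fv_trm t \<subseteq> {..<m + n}" if "t \<in> set (vars m n)" for t m n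
    using that by (auto simp: vars_def)
  have inc: "fv (increasing_in_I (vars 0 n)) \<subseteq> {..<n}" for n
    using vars[of _ 0 n] list.set_sel(2)[of "vars 0 n"]
    by (cases "vars 0 n = []") (fastforce simp: increasing_in_I_def fv_Conjs dest: set_zip_leftD set_zip_rightD)+
  consider "\<gamma> \<in> PA_basic" | m \<phi> where "\<gamma> = induction_axiom m \<phi>" "fv \<phi> \<subseteq> {..m}"
    | "\<gamma> = unbounded_I" | n \<phi> where "\<gamma> = indiscernibility_axiom n \<phi>" "fv \<phi> \<subseteq> {..<n}"
    using assms unfolding PAI_def by blast
  then show ?thesis
  proof cases
    case 1
    then show ?thesis by (auto simp: PA_basic_def fv_Foralls)
  next
    case (2 m \<phi>)
    have "k < m" if "k \<in> fv (subst0 Zero \<phi>)" for k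
      using that 2(2) by (auto simp: subst0_def fv_subst gr0_conv_Suc split: nat.splits)
    moreover have "k \<le> m" if "k \<in> fv (subst (case_nat (Succ (Var 0)) (\<lambda>k. Var (Suc k))) \<phi>)" (is ?k) for k
    proof -
      obtain l where "l \<in> fv \<phi>" "k \<in> fv_trm (case_nat (Succ (Var 0)) (\<lambda>k. Var (Suc k)) l)"
        using \<open>?k\<close> unfolding fv_subst by blast
      then show ?thesis using 2(2) by (cases l) auto
    qed
    ultimately show ?thesis
      using 2(2) unfolding 2(1) induction_axiom_def fv_Foralls by fastforce
  next
    case 3
    then show ?thesis by (auto simp: unbounded_I_def)
  next
    case (4 n \<phi>)
    have "fv (inst \<phi> (vars m n)) \<subseteq> {..<m + n}" for m
    proof -
      have "fv_trm (vars m n ! k) \<subseteq> {..<m + n}" if "k < n" for k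
        using that by (intro vars) simp
      then show ?thesis using 4(2) by (fastforce simp: inst_def fv_subst split: if_splits)
    qed
    from this[of n] this[of 0] show ?thesis
      using inc[of n] unfolding 4(1) indiscernibility_axiom_def Forall_inc_I_def fv_Foralls
      by (fastforce simp: fv_Foralls)
  qed
qed

section \<open>Models of PAI\<close>

text \<open>\<open>lex_le c q a b\<close> compares the sequences of truth values of \<open>a\<close> and \<open>b\<close> at the \<open>q\<close>-tuples
  below variable \<open>c\<close>, in lexicographic order.\<close>

definition skip :: "nat \<Rightarrow> trm" where
  "skip = case_nat (Var 0) (\<lambda>k. Var (k + 2))"

primrec lex_le :: "nat \<Rightarrow> nat \<Rightarrow> form \<Rightarrow> form \<Rightarrow> form" where
  "lex_le c 0 a b = (a \<^bold>\<longrightarrow> b)"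
| "lex_le c (Suc q) a b = Forall (Var 0 \<^bold>< Var (Suc c) \<^bold>\<longrightarrow>
     Forall (Var 0 \<^bold>< Var 1 \<^bold>\<longrightarrow>
       subst skip (lex_le (Suc c) q a b \<^bold>\<and> lex_le (Suc c) q b a)) \<^bold>\<longrightarrow>
     lex_le (Suc c) q a b)"

definition lex_eq :: "nat \<Rightarrow> nat \<Rightarrow> form \<Rightarrow> form \<Rightarrow> form" where
  "lex_eq c q a b = (lex_le c q a b \<^bold>\<and> lex_le c q b a)"

lemma LA_lex_le: "LA_form a \<Longrightarrow> LA_form b \<Longrightarrow> LA_form (lex_le c q a b)"
  by (induction q arbitrary: c a b) auto

text \<open>Under the inner quantifier \<open>y\<close> stands on top of \<open>x\<close>, whereas
  the section at \<open>y\<close> is to be read with \<open>y\<close> in the place of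
  \<open>x\<close>; \<open>skip\<close> steps over \<open>x\<close>.\<close>

lemma sat_skip:
  "sat M (case_nat y (case_nat x e)) (subst skip \<phi>) \<longleftrightarrow> sat M (case_nat y e) \<phi>"
proof -
  have "(\<lambda>k. val M (case_nat y (case_nat x e)) (skip k)) = case_nat y e"
    by (rule ext) (simp add: skip_def split: nat.split)
  then show ?thesis by (simp add: sat_subst)
qed

lemma sat_lex_eq: "sat M e (lex_eq c q a b) \<longleftrightarrow> sat M e (lex_le c q a b) \<and> sat M e (lex_le c q b a)"
  by (simp add: lex_eq_def)

text \<open>This is the lexicographic order on words whose letter at position \<open>x\<close> is
  the section at \<open>x\<close>, the letters being compared by the same order in \<open>q\<close>
  coordinates. The bound moves from index \<open>c\<close> to \<open>Suc c\<close> because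
  \<open>x\<close> adds a variable.\<close>

lemma sat_lex_le_Suc:
  "sat M e (lex_le c (Suc q) a b) \<longleftrightarrow> (\<forall>x. lessM M x (e c) \<longrightarrow>
    (\<forall>y. lessM M y x \<longrightarrow> sat M (case_nat y e) (lex_eq (Suc c) q a b)) \<longrightarrow>
    sat M (case_nat x e) (lex_le (Suc c) q a b))"
  by (simp add: sat_skip sat_lex_eq)

lemma sat_ForallsD: "sat M e (Foralls n \<phi>) \<Longrightarrow> length xs = n \<Longrightarrow> sat M (env xs e) \<phi>"
  by (simp add: sat_Foralls)

section \<open>Induction, order and bounds in a model\<close>

locale PAI_model =
  fixes M :: "'a model"
  assumes model: "\<gamma> \<in> PAI \<Longrightarrow> sat M e \<gamma>"
begin

abbreviation lt (infix "\<prec>" 50) where "x \<prec> y \<equiv> lessM M x y"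

definition inc :: "'a list \<Rightarrow> bool" where
  "inc xs \<longleftrightarrow> (\<forall>x\<in>set xs. inM M x) \<and> sorted_wrt (\<prec>) xs"

lemma PA_basic: "\<gamma> \<in> PA_basic \<Longrightarrow> sat M e \<gamma>"
  using model by (simp add: PAI_def)

lemma not_lt_zero: "\<not> x \<prec> zeroM M"
  using PA_basic[of "Foralls 1 (\<^bold>\<not> (Var 0 \<^bold>< Zero))"]
  by (simp add: PA_basic_def Foralls_def)

lemma lt_succ: "x \<prec> succM M y \<longleftrightarrow> x \<prec> y \<or> x = y"
  using PA_basic[of "Foralls 2 (Var 1 \<^bold>< Succ (Var 0) \<^bold>\<longleftrightarrow> Var 1 \<^bold>< Var 0 \<^bold>\<or> Var 1 \<^bold>= Var 0)"]
  by (simp add: PA_basic_def Foralls_def numeral_2_eq_2) metis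

lemma M_induct:
  assumes "sat M (case_nat (zeroM M) e) \<phi>"
    and "\<And>x. sat M (case_nat x e) \<phi> \<Longrightarrow> sat M (case_nat (succM M x) e) \<phi>"
  shows "sat M (case_nat x e) \<phi>"
proof -
  obtain m where "fv \<phi> \<subseteq> {..m}"
    using finite_fv[of \<phi>] unfolding finite_nat_iff_bounded_le ..
  then have "induction_axiom m \<phi> \<in> PAI" by (auto simp: PAI_def)
  \<comment> \<open>The shift by \<open>m\<close> is undone when the \<open>m\<close> outer
    quantifiers are filled with the first \<open>m\<close> values of \<open>e\<close>.\<close>
  then have "sat M (\<lambda>k. e (k + m)) (induction_axiom m \<phi>)" by (rule model)
  then have ax: "sat M (env (map e [0..<m]) (\<lambda>k. e (k + m))) (subst0 Zero \<phi> \<^bold>\<longrightarrow>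
       Forall (\<phi> \<^bold>\<longrightarrow> subst (case_nat (Succ (Var 0)) (\<lambda>k. Var (Suc k))) \<phi>) \<^bold>\<longrightarrow> Forall \<phi>)"
    unfolding induction_axiom_def by (rule sat_ForallsD) simp
  have eq: "(\<lambda>k. val M (case_nat x e) (case_nat (Succ (Var 0)) (\<lambda>k. Var (Suc k)) k))
      = case_nat (succM M x) e" for x
    by (rule ext) (simp split: nat.split)
  have "sat M (case_nat (zeroM M) e) \<phi> \<longrightarrow>
      (\<forall>x. sat M (case_nat x e) \<phi> \<longrightarrow> sat M (case_nat (succM M x) e) \<phi>) \<longrightarrow>
      (\<forall>x. sat M (case_nat x e) \<phi>)"
    using ax unfolding sat.simps env_drop sat_subst0 sat_subst eq val.simps .
  then show ?thesis using assms by blast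
qed

lemma definable_induct:
  assumes "\<And>x. P x \<longleftrightarrow> sat M (case_nat x e) \<phi>" "P (zeroM M)" "\<And>x. P x \<Longrightarrow> P (succM M x)"
  shows "P x"
  using assms(2,3) unfolding assms(1) by (rule M_induct)

lemma lt_trans: "x \<prec> y \<Longrightarrow> y \<prec> z \<Longrightarrow> x \<prec> z"
proof (induction z rule: definable_induct[where e = "env [x, y] undefined" and
      \<phi> = "Var 1 \<^bold>< Var 2 \<^bold>\<longrightarrow> Var 2 \<^bold>< Var 0 \<^bold>\<longrightarrow> Var 1 \<^bold>< Var 0", case_names def zero succ])
  case (def z)
  show ?case by (simp add: numeral_2_eq_2)
next
  case zero
  then show ?case by (simp add: not_lt_zero)
next
  case (succ z)
  then show ?case by (auto simp: lt_succ)
qed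

lemma transp_lt: "transp (\<prec>)"
  by (rule transpI) (rule lt_trans)

lemma lt_succ_self: "x \<prec> succM M x"
  by (simp add: lt_succ)

lemma zero_le: "zeroM M \<prec> x \<or> zeroM M = x"
proof (induction x rule: definable_induct[where e = undefined and
      \<phi> = "Zero \<^bold>< Var 0 \<^bold>\<or> Zero \<^bold>= Var 0", case_names def zero succ])
  case (succ x)
  then show ?case by (auto simp: lt_succ)
qed auto

lemma succ_mono: "x \<prec> y \<Longrightarrow> succM M x \<prec> succM M y"
proof (induction y rule: definable_induct[where e = "env [x] undefined" and
      \<phi> = "Var 1 \<^bold>< Var 0 \<^bold>\<longrightarrow> Succ (Var 1) \<^bold>< Succ (Var 0)", case_names def zero succ])
  case (succ y)
  then show ?case by (auto simp: lt_succ)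
qed (simp_all add: not_lt_zero)

lemma lt_total: "x \<prec> y \<or> x = y \<or> y \<prec> x"
proof (induction x rule: definable_induct[where e = "env [y] undefined" and
      \<phi> = "Var 0 \<^bold>< Var 1 \<^bold>\<or> Var 0 \<^bold>= Var 1 \<^bold>\<or> Var 1 \<^bold>< Var 0", case_names def zero succ])
  case zero
  then show ?case using zero_le by blast
next
  case (succ x)
  then show ?case using succ_mono[of x y] lt_succ by auto
qed auto

lemma M_less_induct:
  assumes step: "\<And>x. (\<And>y. y \<prec> x \<Longrightarrow> sat M (case_nat y e) \<phi>) \<Longrightarrow> sat M (case_nat x e) \<phi>"
  shows "sat M (case_nat x e) \<phi>"
proof -
  let ?\<phi> = "Forall (Var 0 \<^bold>< Var 1 \<^bold>\<longrightarrow> subst skip \<phi>)"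
  have below: "sat M (case_nat x e) ?\<phi> \<longleftrightarrow> (\<forall>y. y \<prec> x \<longrightarrow> sat M (case_nat y e) \<phi>)" for x
    by (simp add: sat_skip)
  have "sat M (case_nat x e) ?\<phi>"
  proof (rule M_induct)
    show "sat M (case_nat (zeroM M) e) ?\<phi>" unfolding below by (simp add: not_lt_zero)
  next
    fix x assume "sat M (case_nat x e) ?\<phi>"
    then have IH: "\<forall>y. y \<prec> x \<longrightarrow> sat M (case_nat y e) \<phi>" unfolding below .
    then have "sat M (case_nat x e) \<phi>" by (blast intro!: step[of x])
    with IH show "sat M (case_nat (succM M x) e) ?\<phi>" unfolding below lt_succ by blast
  qed
  then have "\<forall>y. y \<prec> x \<longrightarrow> sat M (case_nat y e) \<phi>" unfolding below .
  then show ?thesis by (blast intro!: step[of x])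
qed

lemma ex_above: "\<exists>c. inM M c \<and> a \<prec> c \<and> b \<prec> c"
proof -
  have "sat M undefined unbounded_I" by (rule model) (simp add: PAI_def)
  then have "\<exists>c. inM M c \<and> a \<prec> c" for a by (auto simp: unbounded_I_def)
  then show ?thesis using lt_total[of a b] lt_trans by metis
qed

text \<open>Induction on \<open>u\<close> produces a common bound for all \<open>x\<close> below
  \<open>u\<close>, and monotonicity merges it with a bound for \<open>u\<close> itself. The second
  hypothesis may use a common bound for all \<open>y\<close> below \<open>x\<close>; the
  stabilisation of the lexicographic order depends on this. \<open>\<theta>\<close> may mention
  I.\<close>

lemma bounding:
  assumes mono: "\<And>x b c. b \<prec> c \<Longrightarrow> sat M (env [b, x] e) \<theta> \<Longrightarrow> sat M (env [c, x] e) \<theta>"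
    and step: "\<And>x. x \<prec> i \<Longrightarrow> \<exists>b. \<forall>y. y \<prec> x \<longrightarrow> sat M (env [b, y] e) \<theta> \<Longrightarrow>
      \<exists>b. sat M (env [b, x] e) \<theta>"
  shows "\<exists>b. \<forall>x. x \<prec> i \<longrightarrow> sat M (env [b, x] e) \<theta>"
proof -
  \<comment> \<open>\<open>\<theta>\<close> expects the stack \<open>b, x\<close>; under the
    quantifiers of \<open>\<Phi>\<close> the stack is \<open>x, b, u, i\<close>.\<close>
  define \<rho> where "\<rho> = case_nat (Var 1) (case_nat (Var 0) (\<lambda>k. Var (k + 4)))"
  have \<rho>: "(\<lambda>k. val M (env [x, b, u, i] e) (\<rho> k)) = env [b, x] e" for x b u
    by (rule ext) (simp add: \<rho>_def numeral_eq_Suc split: nat.split)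
  \<comment> \<open>The guard keeps \<open>u\<close> at most \<open>i\<close>, since
    \<open>step\<close> gives bounds only for arguments below \<open>i\<close>.\<close>
  define \<Phi> where "\<Phi> = ((Var 0 \<^bold>< Var 1 \<^bold>\<or> Var 0 \<^bold>= Var 1) \<^bold>\<longrightarrow>
    Exists (Forall (Var 0 \<^bold>< Var 2 \<^bold>\<longrightarrow> subst \<rho> \<theta>)))"
  have \<Phi>: "sat M (case_nat u (env [i] e)) \<Phi> \<longleftrightarrow>
      (u \<prec> i \<or> u = i \<longrightarrow> (\<exists>b. \<forall>x. x \<prec> u \<longrightarrow> sat M (env [b, x] e) \<theta>))" for u
    using \<rho> by (simp add: \<Phi>_def sat_subst numeral_2_eq_2) blast
  have "sat M (case_nat i (env [i] e)) \<Phi>"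
  proof (rule M_induct)
    fix u assume IH: "sat M (case_nat u (env [i] e)) \<Phi>"
    show "sat M (case_nat (succM M u) (env [i] e)) \<Phi>"
      unfolding \<Phi>
    proof
      assume "succM M u \<prec> i \<or> succM M u = i"
      then have u: "u \<prec> i" using lt_succ_self lt_trans by blast
      then obtain b where b: "\<forall>x. x \<prec> u \<longrightarrow> sat M (env [b, x] e) \<theta>" using IH unfolding \<Phi> by blast
      with step[OF u] obtain b' where b': "sat M (env [b', u] e) \<theta>" by blast
      obtain c where "b \<prec> c" "b' \<prec> c" using ex_above by blast
      then show "\<exists>b. \<forall>x. x \<prec> succM M u \<longrightarrow> sat M (env [b, x] e) \<theta>"
        using b b' mono unfolding lt_succ by blast
    qed
  qed (simp only: \<Phi> not_lt_zero, simp)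
  then show ?thesis unfolding \<Phi> by blast
qed

section \<open>Increasing tuples from I and indiscernibility\<close>

lemma sat_increasing: "sat M e (increasing_in_I ts) \<longleftrightarrow> inc (map (val M e) ts)"
proof -
  have "(\<forall>p\<in>set (zip ts (tl ts)). sat M e (case p of (s, t) \<Rightarrow> s \<^bold>< t)) \<longleftrightarrow>
    (\<forall>(x, y)\<in>set (zip (map (val M e) ts) (tl (map (val M e) ts))). x \<prec> y)"
    by (auto simp: zip_map_map simp flip: map_tl)
  then show ?thesis
    unfolding increasing_in_I_def inc_def sorted_wrt_iff_zip[OF transp_lt, symmetric]
    by (simp add: sat_Conjs)
qed

lemma sat_Forall_inc_I:
  "sat M e (Forall_inc_I r \<phi>) \<longleftrightarrow>
    (\<forall>xs. length xs = r \<longrightarrow> inc xs \<longrightarrow> sat M (env (rev xs) e) \<phi>)"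
  by (simp add: Forall_inc_I_def sat_Foralls_rev sat_increasing map_val_vars cong: conj_cong)

lemma sat_Forall_inc_ID:
  "sat M e (Forall_inc_I r \<phi>) \<Longrightarrow> length xs = r \<Longrightarrow> inc xs \<Longrightarrow> sat M (env (rev xs) e) \<phi>"
  by (simp add: sat_Forall_inc_I)

text \<open>The axiom admits only formulae whose variables are covered by the tuple. Here all
  further variables have the value zero, so the term \<open>Zero\<close> may be substituted for them
  first. The two tuples may lie in any position to each other.\<close>

lemma indiscernible:
  assumes "LA_form \<phi>" "inc xs" "inc ys" "length ys = length xs"
  shows "sat M (env xs (\<lambda>_. zeroM M)) \<phi> \<longleftrightarrow> sat M (env ys (\<lambda>_. zeroM M)) \<phi>"
proof -
  define n where "n = length xs"
  define \<psi> where "\<psi> = subst (\<lambda>k. if k < n then Var k else Zero) \<phi>"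
  have "LA_form \<psi>" "fv \<psi> \<subseteq> {..<n}"
    using assms(1) by (auto simp: \<psi>_def fv_subst split: if_splits)
  then have fv: "fv \<psi> \<subseteq> {..<length (vars m n)}" for m by simp
  have "indiscernibility_axiom n \<psi> \<in> PAI"
    using \<open>LA_form \<psi>\<close> \<open>fv \<psi> \<subseteq> {..<n}\<close> by (auto simp: PAI_def)
  then have "sat M (\<lambda>_. zeroM M) (indiscernibility_axiom n \<psi>)" by (rule model)
  then have "sat M (env (rev ys) (env (rev xs) (\<lambda>_. zeroM M)))
      (inst \<psi> (vars n n) \<^bold>\<longleftrightarrow> inst \<psi> (vars 0 n))"
    unfolding indiscernibility_axiom_def
    by (rule sat_Forall_inc_ID[OF sat_Forall_inc_ID]) (use assms n_def in simp_all)
  then have "sat M (env xs (\<lambda>_. zeroM M)) \<psi> \<longleftrightarrow> sat M (env ys (\<lambda>_. zeroM M)) \<psi>"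
    using assms(4) by (simp add: n_def[symmetric] sat_inst[OF fv, where e' = "\<lambda>_. zeroM M"] map_val_vars) blast
  moreover have "(\<lambda>k. val M (env zs (\<lambda>_. zeroM M)) (if k < n then Var k else Zero)) = env zs (\<lambda>_. zeroM M)"
    if "length zs = n" for zs
    using that by (auto simp: env_eq)
  ultimately show ?thesis using assms(4) by (simp add: \<psi>_def sat_subst n_def)
qed

lemma inc_append:
  assumes "inc xs" "inc ys" "xs \<noteq> []" "ys \<noteq> []" "last xs \<prec> hd ys"
  shows "inc (xs @ ys)"
proof -
  have "x \<prec> y" if "x \<in> set xs" "y \<in> set ys" for x y
  proof -
    have "x = last xs \<or> x \<prec> last xs"
      using that assms(1,3) by (cases xs rule: rev_cases) (auto simp: inc_def sorted_wrt_append)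
    then have "x \<prec> hd ys" using assms(5) lt_trans by blast
    moreover have "y = hd ys \<or> hd ys \<prec> y"
      using that assms(2,4) by (cases ys) (auto simp: inc_def)
    ultimately show ?thesis using lt_trans by blast
  qed
  then show ?thesis using assms(1,2) by (auto simp: inc_def sorted_wrt_append)
qed

lemma inc_appendD: "inc (xs @ ys) \<Longrightarrow> inc xs \<and> inc ys"
  by (auto simp: inc_def sorted_wrt_append)

lemma inc_Cons: "inM M i \<Longrightarrow> inc xs \<Longrightarrow> xs \<noteq> [] \<Longrightarrow> i \<prec> hd xs \<Longrightarrow> inc (i # xs)"
  using inc_append[of "[i]" xs] by (simp add: inc_def)

lemma ex_inc: "\<exists>xs. length xs = Suc n \<and> inc xs \<and> b \<prec> hd xs"
proof (induction n arbitrary: b)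
  case 0
  obtain c where "inM M c" "b \<prec> c" using ex_above by blast
  then show ?case by (intro exI[of _ "[c]"]) (auto simp: inc_def)
next
  case (Suc n)
  obtain c where c: "inM M c" "b \<prec> c" using ex_above by blast
  obtain xs where "length xs = Suc n" "inc xs" "c \<prec> hd xs" using Suc by blast
  then show ?case using c by (intro exI[of _ "c # xs"]) (auto intro: inc_Cons)
qed

section \<open>Collection for tuples and apartness\<close>

lemma sat_below:
  assumes "length xs = n"
  shows "sat M (env xs e) (Conjs (map (\<lambda>k. Var k \<^bold>< Var m) [0..<n])) \<longleftrightarrow>
    (\<forall>x\<in>set xs. x \<prec> env xs e m)"
  unfolding sat_Conjs using assms by (auto simp: env_eq all_set_conv_all_nth)

text \<open>Induction on the number of coordinates: for a fixed last coordinate \<open>x\<close> the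
  others have a bound depending on the parameter \<open>x\<close>, and \<open>bounding\<close>
  unites these bounds over all \<open>x\<close> below \<open>i\<close>.\<close>

lemma collection:
  "\<exists>b. \<forall>xs. length xs = q \<longrightarrow> (\<forall>x\<in>set xs. x \<prec> i) \<longrightarrow>
    (\<exists>y. sat M (case_nat y (env xs e)) \<phi>) \<longrightarrow> (\<exists>y. y \<prec> b \<and> sat M (case_nat y (env xs e)) \<phi>)"
proof (induction q arbitrary: e)
  case 0
  show ?case
  proof (cases "\<exists>y. sat M (case_nat y e) \<phi>")
    case True
    then obtain y where "sat M (case_nat y e) \<phi>" by blast
    then show ?thesis using lt_succ_self[of y] by auto
  qed auto
next
  case (Suc q)
  let ?bd = "\<lambda>b xs e. (\<exists>y. sat M (case_nat y (env xs e)) \<phi>) \<longrightarrow>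
    (\<exists>y. y \<prec> b \<and> sat M (case_nat y (env xs e)) \<phi>)"
  \<comment> \<open>Reads a formula meant for the stack \<open>y, xs, x, e\<close> in the stack
    \<open>y, xs, b, x, i, e\<close>.\<close>
  define \<rho> where "\<rho> k = Var (if k \<le> q then k else if k = Suc q then q + 2 else k + 2)" for k
  have \<rho>: "(\<lambda>k. val M (case_nat y (env xs (env [b, x, i] e))) (\<rho> k)) = case_nat y (env xs (case_nat x e))"
    if "length xs = q" for y xs b x
    using that
    by (intro ext) (auto simp: \<rho>_def env_eq nth_Cons' split: nat.split simp flip: env.simps intro!: arg_cong[where f = e])
  define \<theta> where "\<theta> = Foralls q (Conjs (map (\<lambda>k. Var k \<^bold>< Var (q + 2)) [0..<q]) \<^bold>\<longrightarrow>
    Exists (subst \<rho> \<phi>) \<^bold>\<longrightarrow> Exists (Var 0 \<^bold>< Var (Suc q) \<^bold>\<and> subst \<rho> \<phi>))"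
  have \<theta>: "sat M (env [b, x] (case_nat i e)) \<theta> \<longleftrightarrow>
    (\<forall>xs. length xs = q \<longrightarrow> (\<forall>x\<in>set xs. x \<prec> i) \<longrightarrow> ?bd b xs (case_nat x e))" for b x
  proof -
    let ?e = "\<lambda>xs. env xs (env [b, x, i] e)"
    have "?e xs (q + 2) = i" "?e xs q = b"
      "sat M (case_nat y (?e xs)) (subst \<rho> \<phi>) \<longleftrightarrow> sat M (case_nat y (env xs (case_nat x e))) \<phi>"
      if "length xs = q" for xs y
      using that \<rho>[OF that] by (simp_all add: sat_subst env_eq del: env.simps)
    then show ?thesis
      by (simp add: \<theta>_def sat_Foralls sat_below cong: imp_cong)
  qed
  have "\<exists>b. \<forall>x. x \<prec> i \<longrightarrow> sat M (env [b, x] (case_nat i e)) \<theta>"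
  proof (rule bounding)
    fix x b c assume "b \<prec> c" "sat M (env [b, x] (case_nat i e)) \<theta>"
    then show "sat M (env [c, x] (case_nat i e)) \<theta>"
      unfolding \<theta> using lt_trans[of _ b c] by blast
  next
    fix x
    show "\<exists>b. sat M (env [b, x] (case_nat i e)) \<theta>"
      unfolding \<theta> by (rule Suc)
  qed
  then obtain b where b: "\<forall>x. x \<prec> i \<longrightarrow> (\<forall>xs. length xs = q \<longrightarrow> (\<forall>x\<in>set xs. x \<prec> i) \<longrightarrow>
      ?bd b xs (case_nat x e))"
    unfolding \<theta> by blast
  show ?case
  proof (rule exI[of _ b], intro allI impI)
    fix xs assume xs: "length xs = Suc q" "\<forall>x\<in>set xs. x \<prec> i" "\<exists>y. sat M (case_nat y (env xs e)) \<phi>"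
    from xs(1) obtain ys x where "xs = ys @ [x]" "length ys = q" by (metis length_Suc_conv_rev)
    moreover from this have "x \<prec> i" "\<forall>x\<in>set ys. x \<prec> i"
      "\<exists>y. sat M (case_nat y (env ys (case_nat x e))) \<phi>"
      using xs(2,3) by auto
    ultimately have "\<exists>y. y \<prec> b \<and> sat M (case_nat y (env ys (case_nat x e))) \<phi>"
      using b by blast
    then show "\<exists>y. y \<prec> b \<and> sat M (case_nat y (env xs e)) \<phi>"
      using \<open>xs = ys @ [x]\<close> by simp
  qed
qed

lemma env_indices:
  assumes "length xs = n"
  shows "k < n \<Longrightarrow> env xs e k = xs ! k" "env xs e (n + k) = e k" "env xs e n = e 0"
    "env xs e (Suc n) = e 1"
  using assms by (auto simp: env_eq)

lemma sat_apartness: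
  assumes "LA_form \<phi>" "fv \<phi> \<subseteq> {..<n + 1}"
  shows "sat M e (apartness n \<phi>)"
proof -
  let ?o = "\<lambda>_::nat. zeroM M"
  \<comment> \<open>\<open>\<phi>\<close> has \<open>y\<close> at index \<open>n\<close>; it is
    moved to index 0, where the existential quantifier of \<open>\<chi>\<close> binds it.\<close>
  define \<psi> where "\<psi> = subst (\<lambda>k. Var (if k < n then Suc k else if k = n then 0 else k)) \<phi>"
  have \<psi>: "sat M (case_nat y (env xs e)) \<psi> \<longleftrightarrow> sat M (env (xs @ [y]) ?o) \<phi>"
    if "length xs = n" for xs y e
    unfolding \<psi>_def sat_subst using assms(2) that
    by (intro sat_cong) (force simp: env_eq nth_append)
  \<comment> \<open>With the parameters below \<open>i\<close> quantified away, an arithmetical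
    formula in \<open>i\<close> and \<open>j\<close> alone remains. Their indices are
    \<open>n\<close> and \<open>n + 1\<close> inside the block, and \<open>j\<close> becomes
    \<open>n + 2\<close> under the quantifier on \<open>y\<close>.\<close>
  define \<chi> where "\<chi> = Foralls n (Conjs (map (\<lambda>k. Var k \<^bold>< Var n) [0..<n]) \<^bold>\<longrightarrow>
    Exists \<psi> \<^bold>\<longrightarrow> Exists (Var 0 \<^bold>< Var (n + 2) \<^bold>\<and> \<psi>))"
  have \<chi>: "sat M (env [i, j] ?o) \<chi> \<longleftrightarrow>
    (\<forall>xs. length xs = n \<longrightarrow> (\<forall>x\<in>set xs. x \<prec> i) \<longrightarrow>
      (\<exists>y. sat M (env (xs @ [y]) ?o) \<phi>) \<longrightarrow> (\<exists>y. y \<prec> j \<and> sat M (env (xs @ [y]) ?o) \<phi>))" for i j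
    by (simp add: \<chi>_def sat_Foralls sat_below \<psi> env_indices del: env_append cong: imp_cong)
  have LA: "LA_form \<chi>" using assms(1) by (auto simp: \<chi>_def \<psi>_def LA_Conjs)
  have main: "sat M (env [i, j] ?o) \<chi>" if "inM M i" "inM M j" "i \<prec> j" for i j
  proof -
    obtain b where b: "\<forall>xs. length xs = n \<longrightarrow> (\<forall>x\<in>set xs. x \<prec> i) \<longrightarrow>
      (\<exists>y. sat M (case_nat y (env xs ?o)) \<psi>) \<longrightarrow> (\<exists>y. y \<prec> b \<and> sat M (case_nat y (env xs ?o)) \<psi>)"
      using collection by blast
    obtain k where k: "inM M k" "i \<prec> k" "b \<prec> k" using ex_above by blast
    have "sat M (env [i, k] ?o) \<chi>"
      unfolding \<chi>
    proof (intro allI impI)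
      fix xs assume "length xs = n" "\<forall>x\<in>set xs. x \<prec> i" "\<exists>y. sat M (env (xs @ [y]) ?o) \<phi>"
      then obtain y where "y \<prec> b" "sat M (case_nat y (env xs ?o)) \<psi>"
        using b \<psi>[of xs _ ?o] by blast
      then show "\<exists>y. y \<prec> k \<and> sat M (env (xs @ [y]) ?o) \<phi>"
        using \<psi>[of xs y ?o] \<open>length xs = n\<close> lt_trans[OF _ k(3)] by blast
    qed
    then show ?thesis
      using indiscernible[OF LA, of "[i, k]" "[i, j]"] that k by (simp add: inc_def)
  qed
  have inst: "sat M (case_nat y (env (rev xs) e)) (inst \<phi> (vars (Suc 0) n @ [Var 0])) \<longleftrightarrow>
      sat M (env (xs @ [y]) ?o) \<phi>" if "length xs = n" for xs y e
  proof -
    have "map (val M (case_nat y (env (rev xs) e))) (vars 1 n @ [Var 0]) = xs @ [y]"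
      using map_val_vars(2)[of "[y]" 1 xs n M e] that by simp
    then show ?thesis
      using assms(2) sat_inst[of \<phi> "vars 1 n @ [Var 0]" M "case_nat y (env (rev xs) e)" ?o] by simp
  qed
  show ?thesis
    using main unfolding \<chi>
    by (simp add: apartness_def Forall_I_def sat_Foralls_below inst env_indices del: env_append cong: imp_cong)
qed

section \<open>Lexicographic comparison and diagonal indiscernibility\<close>

text \<open>Each failure of \<open>lex_le\<close> comes with a first differing position. If both
  directions failed, these positions would coincide, since a smaller one would lie where the other
  failure grants equality. At the common position the induction hypothesis refutes one of the
  failures.\<close>

lemma lex_le_total: "sat M e (lex_le c q a b) \<or> sat M e (lex_le c q b a)"
proof (induction q arbitrary: c e)
  case (Suc q)
  show ?case
  proof (rule ccontr)
    assume "\<not> ?thesis"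
    then obtain x y where
      x: "\<And>z. z \<prec> x \<Longrightarrow> sat M (case_nat z e) (lex_eq (Suc c) q a b)"
         "\<not> sat M (case_nat x e) (lex_le (Suc c) q a b)" and
      y: "\<And>z. z \<prec> y \<Longrightarrow> sat M (case_nat z e) (lex_eq (Suc c) q b a)"
         "\<not> sat M (case_nat y e) (lex_le (Suc c) q b a)"
      unfolding sat_lex_le_Suc by blast
    have "x = y" using lt_total[of x y] x y unfolding sat_lex_eq by blast
    then show False using Suc x(2) y(2) by blast
  qed
qed auto

lemma lex_eq_SucI:
  "(\<And>x. x \<prec> e c \<Longrightarrow> sat M (case_nat x e) (lex_eq (Suc c) q a b)) \<Longrightarrow> sat M e (lex_eq c (Suc q) a b)"
  unfolding sat_lex_eq sat_lex_le_Suc by blast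

text \<open>The two inequalities bear only on positions whose predecessors agree. Strong induction
  inside the model therefore propagates agreement to all positions below the bound.\<close>

lemma lex_eq_imp_eq:
  assumes "sat M e (lex_eq c q a b)" "length xs = q" "\<forall>x\<in>set xs. x \<prec> e c"
  shows "sat M (env xs e) a \<longleftrightarrow> sat M (env xs e) b"
  using assms
proof (induction q arbitrary: c e xs)
  case 0
  then show ?case by (auto simp: sat_lex_eq)
next
  case (Suc q)
  have below: "sat M (case_nat x e) (Var 0 \<^bold>< Var (Suc c) \<^bold>\<longrightarrow> lex_eq (Suc c) q a b)" for x
  proof (rule M_less_induct)
    fix x assume IH: "\<And>y. y \<prec> x \<Longrightarrow> sat M (case_nat y e) (Var 0 \<^bold>< Var (Suc c) \<^bold>\<longrightarrow> lex_eq (Suc c) q a b)"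
    have "sat M (case_nat x e) (lex_eq (Suc c) q a b)" if x: "x \<prec> e c"
    proof -
      have "sat M (case_nat y e) (lex_eq (Suc c) q a b)" if "y \<prec> x" for y
        using IH[OF that] lt_trans[OF that x] by simp
      then show ?thesis
        using Suc.prems(1) x unfolding sat_lex_eq sat_lex_le_Suc by blast
    qed
    then show "sat M (case_nat x e) (Var 0 \<^bold>< Var (Suc c) \<^bold>\<longrightarrow> lex_eq (Suc c) q a b)" by simp
  qed
  obtain ys x where xs: "xs = ys @ [x]" "length ys = q"
    using Suc.prems(2) by (metis length_Suc_conv_rev)
  then have "sat M (case_nat x e) (lex_eq (Suc c) q a b)"
    using below[of x] Suc.prems(3) by simp
  then show ?case
    using Suc.IH[of "case_nat x e" "Suc c" ys] xs Suc.prems(3) by simp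
qed

text \<open>As the tuple increases, comparing its head with \<open>b\<close> puts all its entries
  beyond \<open>b\<close>. The main use is \<open>N = r + r\<close>, for two consecutive tuples of
  length \<open>r\<close>.\<close>

definition past :: "nat \<Rightarrow> 'a \<Rightarrow> 'a list \<Rightarrow> bool" where
  "past N b zs \<longleftrightarrow> length zs = N \<and> inc zs \<and> b \<prec> hd zs"

lemma past_mono: "past N c zs \<Longrightarrow> b \<prec> c \<Longrightarrow> past N b zs"
  unfolding past_def using lt_trans by blast

text \<open>Here \<open>xs\<close> holds the coordinates fixed so far, and \<open>base\<close>
  freezes a fully specified position. Once all sections at \<open>y < x\<close> agree beyond a
  threshold, the lexicographic inequality passes to the section at \<open>x\<close>, which the
  induction on \<open>q\<close> freezes beyond a further threshold. \<open>bounding\<close> turns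
  these into one threshold for all \<open>x < i\<close>.\<close>

lemma lex_stabilises:
  fixes a b :: form and N n :: nat and i :: 'a and e :: "nat \<Rightarrow> 'a"
  assumes "N > 0"
    and base: "\<And>xs c. length xs = n \<Longrightarrow>
      \<forall>zs. past N c zs \<longrightarrow> sat M (env (xs @ i # zs) e) (a \<^bold>\<longrightarrow> b) \<Longrightarrow>
      \<exists>d. \<forall>zs. past N d zs \<longrightarrow> sat M (env (xs @ i # zs) e) (b \<^bold>\<longrightarrow> a)"
    and "length xs + q = n"
    and "\<forall>zs. past N c zs \<longrightarrow> sat M (env (xs @ i # zs) e) (lex_le (length xs) q a b)"
  shows "\<exists>d. \<forall>zs. past N d zs \<longrightarrow> sat M (env (xs @ i # zs) e) (lex_eq (length xs) q a b)"
  using assms(3,4)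
proof (induction q arbitrary: xs c)
  case 0
  then obtain d where d: "\<forall>zs. past N d zs \<longrightarrow> sat M (env (xs @ i # zs) e) (b \<^bold>\<longrightarrow> a)"
    using base[of xs c] by auto
  obtain d' where "c \<prec> d'" "d \<prec> d'" using ex_above by blast
  then show ?case
    using 0(2) d past_mono unfolding sat_lex_eq lex_le.simps by metis
next
  case (Suc q)
  let ?m = "length xs"
  let ?eq = "lex_eq (Suc ?m) q a b"
  \<comment> \<open>The comparison expects the stack \<open>x, xs, i, zs, e\<close>, while the body
    of \<open>\<theta>\<close> lives in \<open>zs, d, x, xs, i, e\<close>.\<close>
  define \<rho> where "\<rho> k = Var (if k = 0 then Suc N else if k \<le> Suc ?m then k + N + 1
    else if k < ?m + 2 + N then k - (?m + 2) else Suc k)" for k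
  have \<rho>: "(\<lambda>k. val M (env zs (env [d, x] (env (xs @ [i]) e))) (\<rho> k)) = env (x # xs @ i # zs) e"
    if "length zs = N" for zs d x
  proof (rule ext)
    fix k
    consider "k = 0" | l where "k = Suc l" "l < ?m" | "k = Suc ?m" | l where "k = ?m + 2 + l" "l < N"
      | l where "k = ?m + 2 + N + l"
      by (metis add_2_eq_Suc' le_add_diff_inverse less_Suc_eq linorder_not_less not0_implies_Suc add_Suc nat_add_left_cancel_less)
    then show "val M (env zs (env [d, x] (env (xs @ [i]) e))) (\<rho> k) = env (x # xs @ i # zs) e k"
      by cases (auto simp: \<rho>_def env_eq nth_append nth_Cons' that simp del: env.simps env_append)
  qed
  \<comment> \<open>The premises express \<open>past N d zs\<close>: variable 0 is the head of
    \<open>zs\<close>, as \<open>N > 0\<close>, and variable \<open>N\<close> is \<open>d\<close>.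
    This formula mentions I.\<close>
  define \<theta> where "\<theta> = Foralls N (increasing_in_I (map Var [0..<N]) \<^bold>\<longrightarrow> Var N \<^bold>< Var 0 \<^bold>\<longrightarrow> subst \<rho> ?eq)"
  have \<theta>: "sat M (env [d, x] (env (xs @ [i]) e)) \<theta> \<longleftrightarrow>
      (\<forall>zs. past N d zs \<longrightarrow> sat M (env ((x # xs) @ i # zs) e) ?eq)" for d x
  proof -
    have "sat M (env zs (env [d, x] (env (xs @ [i]) e)))
        (increasing_in_I (map Var [0..<N]) \<^bold>\<longrightarrow> Var N \<^bold>< Var 0 \<^bold>\<longrightarrow> subst \<rho> ?eq) \<longleftrightarrow>
      (past N d zs \<longrightarrow> sat M (env ((x # xs) @ i # zs) e) ?eq)" if "length zs = N" for zs
    proof -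
      have "env zs f 0 = hd zs" "env zs (env [d, x] f) N = d" for f
        using that \<open>N > 0\<close> by (auto simp: env_eq hd_conv_nth)
      moreover have "map (env zs f) [0..<N] = zs" for f
        using map_env[of zs f] that by simp
      ultimately show ?thesis
        using that by (simp add: past_def sat_increasing comp_def sat_subst \<rho> del: env.simps env_append) auto
    qed
    then show ?thesis unfolding \<theta>_def sat_Foralls past_def by blast
  qed
  have "\<exists>d. \<forall>x. x \<prec> i \<longrightarrow> sat M (env [d, x] (env (xs @ [i]) e)) \<theta>"
  proof (rule bounding)
    fix x d d' assume "d \<prec> d'" "sat M (env [d, x] (env (xs @ [i]) e)) \<theta>"
    then show "sat M (env [d', x] (env (xs @ [i]) e)) \<theta>"
      unfolding \<theta> using past_mono by blast
  next
    fix x assume x: "x \<prec> i"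
      and "\<exists>d. \<forall>y. y \<prec> x \<longrightarrow> sat M (env [d, y] (env (xs @ [i]) e)) \<theta>"
    then obtain d where d: "\<And>y zs. y \<prec> x \<Longrightarrow> past N d zs \<Longrightarrow> sat M (env ((y # xs) @ i # zs) e) ?eq"
      unfolding \<theta> by blast
    obtain d' where d': "c \<prec> d'" "d \<prec> d'" using ex_above by blast
    have "sat M (env ((x # xs) @ i # zs) e) (lex_le (length (x # xs)) q a b)" if "past N d' zs" for zs
    proof -
      have "sat M (env (xs @ i # zs) e) (lex_le ?m (Suc q) a b)"
        using Suc.prems(2) past_mono[OF that d'(1)] by blast
      moreover have "env (xs @ i # zs) e ?m = i" by (simp add: env_eq)
      moreover have "\<forall>y. y \<prec> x \<longrightarrow> sat M (case_nat y (env (xs @ i # zs) e)) ?eq"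
        using d past_mono[OF that d'(2)] by simp
      ultimately show ?thesis using x unfolding sat_lex_le_Suc by simp
    qed
    then show "\<exists>d. sat M (env [d, x] (env (xs @ [i]) e)) \<theta>"
      unfolding \<theta> using Suc.IH[of "x # xs" d'] Suc.prems(1) by simp
  qed
  then obtain d where d: "\<And>x zs. x \<prec> i \<Longrightarrow> past N d zs \<Longrightarrow> sat M (env ((x # xs) @ i # zs) e) ?eq"
    unfolding \<theta> by blast
  have "sat M (env (xs @ i # zs) e) (lex_eq ?m (Suc q) a b)" if "past N d zs" for zs
  proof (rule lex_eq_SucI)
    fix x assume "x \<prec> env (xs @ i # zs) e ?m"
    then have "x \<prec> i" by (simp add: env_eq)
    then show "sat M (case_nat x (env (xs @ i # zs) e)) ?eq" using d[OF _ that] by simp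
  qed
  then show ?case by blast
qed

text \<open>A property inherited by later tuples changes its truth value at most once. If it holds
  at some \<open>zs\<close> beyond \<open>c\<close>, it holds at the tuples beyond
  \<open>last zs\<close>; otherwise it fails beyond \<open>c\<close>.\<close>

lemma eventually_constant:
  assumes "r > 0" and imp: "\<And>xs ys. length xs = r \<Longrightarrow> past (r + r) c (xs @ ys) \<Longrightarrow> P xs \<Longrightarrow> P ys"
  shows "\<exists>d. \<forall>xs ys. length xs = r \<longrightarrow> past (r + r) d (xs @ ys) \<longrightarrow> P ys \<longrightarrow> P xs"
proof (cases "\<exists>zs. length zs = r \<and> inc zs \<and> c \<prec> hd zs \<and> P zs")
  case True
  then obtain zs where zs: "length zs = r" "inc zs" "c \<prec> hd zs" "P zs" by blast
  show ?thesis
  proof (rule exI[of _ "last zs"], intro allI impI)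
    fix xs ys assume xs: "length xs = r" and past: "past (r + r) (last zs) (xs @ ys)"
    have ne: "xs \<noteq> []" "zs \<noteq> []" using xs zs(1) \<open>r > 0\<close> by auto
    have "inc xs" using past inc_appendD[of xs ys] by (simp add: past_def)
    moreover have "last zs \<prec> hd xs" using past ne by (simp add: past_def)
    ultimately have "inc (zs @ xs)" using zs(2) ne by (intro inc_append)
    then have "past (r + r) c (zs @ xs)" using ne zs(1,3) xs by (simp add: past_def)
    then show "P xs" using imp[OF zs(1) _ zs(4)] by blast
  qed
next
  case False
  have "\<not> P ys" if "length xs = r" "past (r + r) c (xs @ ys)" for xs ys
  proof -
    have ne: "xs \<noteq> []" "ys \<noteq> []" using that \<open>r > 0\<close> by (auto simp: past_def)
    then have "hd xs \<prec> hd ys"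
      using that(2) by (simp add: past_def inc_def sorted_wrt_append)
    then have "c \<prec> hd ys" using that(2) ne lt_trans[of c "hd xs" "hd ys"] by (simp add: past_def)
    then show ?thesis using False that inc_appendD[of xs ys] by (auto simp: past_def)
  qed
  then show ?thesis by (intro exI[of _ c]) blast
qed

lemma diagonal:
  assumes LA: "LA_form \<phi>" and fv: "fv \<phi> \<subseteq> {..<n + 1 + r}" and "r > 0" and i: "inM M i"
    and js: "length js = r" "inc js" "i \<prec> hd js" and ks: "length ks = r" "inc ks" "i \<prec> hd ks"
    and xs: "length xs = n" "\<forall>x\<in>set xs. x \<prec> i"
  shows "sat M (env (xs @ i # js) (\<lambda>_. zeroM M)) \<phi> \<longleftrightarrow> sat M (env (xs @ i # ks) (\<lambda>_. zeroM M)) \<phi>"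
proof -
  let ?o = "\<lambda>_::nat. zeroM M"
  let ?N = "r + r"
  define p where "p xs js \<longleftrightarrow> sat M (env (xs @ i # js) ?o) \<phi>" for xs js
  \<comment> \<open>On the stack \<open>xs, i, js, ks\<close> the formula \<open>\<phi>\<close>
    reads \<open>js\<close>; the shift by \<open>r\<close> makes \<open>\<psi>\<close> read
    \<open>ks\<close> instead. Comparing \<open>\<phi>\<close> with \<open>\<psi>\<close> thus
    compares two consecutive tuples.\<close>
  define \<psi> where "\<psi> = subst (\<lambda>k. Var (if k \<le> n then k else k + r)) \<phi>"
  have \<phi>: "sat M (env (xs @ i # js @ ks) ?o) \<phi> \<longleftrightarrow> p xs js" if "length xs = n" "length js = r" for xs js ks
    unfolding p_def using fv that
    by (intro sat_cong) (force simp: env_eq nth_append nth_Cons' simp del: env.simps env_append)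
  have \<psi>: "sat M (env (xs @ i # js @ ks) ?o) \<psi> \<longleftrightarrow> p xs ks"
    if "length xs = n" "length js = r" "length ks = r" for xs js ks
    unfolding p_def \<psi>_def sat_subst using fv that
    by (intro sat_cong) (force simp: env_eq nth_append nth_Cons' simp del: env.simps env_append)
  have split: "\<exists>js ks. zs = js @ ks \<and> length js = r \<and> length ks = r" if "length zs = ?N" for zs :: "'a list"
    using that by (intro exI[of _ "take r zs"] exI[of _ "drop r zs"]) simp
  have "LA_form \<psi>" using LA by (simp add: \<psi>_def)
  have indisc: "sat M (env (i # zs) ?o) \<chi> \<longleftrightarrow> sat M (env (i # zs') ?o) \<chi>"
    if "LA_form \<chi>" "past ?N i zs" "past ?N i zs'" for \<chi> zs zs'
    using that i \<open>r > 0\<close> by (intro indiscernible inc_Cons) (auto simp: past_def)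
  have ex_past: "\<exists>zs. past ?N d zs \<and> past ?N i zs" for d
  proof -
    obtain d' where "d \<prec> d'" "i \<prec> d'" using ex_above by blast
    moreover obtain zs where "past ?N d' zs"
      using ex_inc[of "?N - 1" d'] \<open>r > 0\<close> by (auto simp: past_def)
    ultimately show ?thesis using past_mono by blast
  qed
  have eventually: "\<exists>d. \<forall>zs. past ?N d zs \<longrightarrow> sat M (env (i # zs) ?o) (lex_eq 0 n a b)"
    if le: "\<forall>zs. past ?N i zs \<longrightarrow> sat M (env (i # zs) ?o) (lex_le 0 n a b)"
      and ab: "a = \<phi> \<and> b = \<psi> \<or> a = \<psi> \<and> b = \<phi>" for a b
  proof -
    have "\<exists>d. \<forall>zs. past ?N d zs \<longrightarrow> sat M (env (xs @ i # zs) ?o) (b \<^bold>\<longrightarrow> a)"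
      if xs: "length xs = n"
        and imp: "\<forall>zs. past ?N c zs \<longrightarrow> sat M (env (xs @ i # zs) ?o) (a \<^bold>\<longrightarrow> b)" for xs c
    proof -
      have at: "(sat M (env (xs @ i # js @ ks) ?o) \<phi> \<longleftrightarrow> p xs js) \<and>
          (sat M (env (xs @ i # js @ ks) ?o) \<psi> \<longleftrightarrow> p xs ks)"
        if "length js = r" "past ?N d (js @ ks)" for js ks d
        using \<phi>[OF xs that(1)] \<psi>[OF xs that(1), of ks] that by (simp add: past_def)
      \<comment> \<open>\<open>P\<close> is the property of tuples at \<open>xs\<close> or its
        negation, so that in both directions of the order \<open>a\<close> implying \<open>b\<close>
        means that \<open>P\<close> passes from \<open>js\<close> to \<open>ks\<close>.\<close>
      have "\<exists>P. \<forall>js ks d. length js = r \<longrightarrow> past ?N d (js @ ks) \<longrightarrow>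
          (sat M (env (xs @ i # js @ ks) ?o) a \<longleftrightarrow> P js) \<and> (sat M (env (xs @ i # js @ ks) ?o) b \<longleftrightarrow> P ks) \<or>
          (sat M (env (xs @ i # js @ ks) ?o) a \<longleftrightarrow> \<not> P ks) \<and> (sat M (env (xs @ i # js @ ks) ?o) b \<longleftrightarrow> \<not> P js)"
        using ab
      proof
        assume "a = \<phi> \<and> b = \<psi>"
        then show ?thesis using at by (intro exI[of _ "p xs"]) blast
      next
        assume "a = \<psi> \<and> b = \<phi>"
        then show ?thesis using at by (intro exI[of _ "\<lambda>js. \<not> p xs js"]) blast
      qed
      then obtain P where P: "sat M (env (xs @ i # js @ ks) ?o) (a \<^bold>\<longrightarrow> b) \<longleftrightarrow> (P js \<longrightarrow> P ks)"
        "sat M (env (xs @ i # js @ ks) ?o) (b \<^bold>\<longrightarrow> a) \<longleftrightarrow> (P ks \<longrightarrow> P js)"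
        if "length js = r" "past ?N d (js @ ks)" for js ks d
        unfolding sat.simps by blast
      have "\<exists>d. \<forall>js ks. length js = r \<longrightarrow> past ?N d (js @ ks) \<longrightarrow> P ks \<longrightarrow> P js"
      proof (rule eventually_constant[OF \<open>r > 0\<close>])
        show "P ks" if "length js = r" "past ?N c (js @ ks)" "P js" for js ks
          using imp P(1)[OF that(1,2)] that by blast
      qed
      then obtain d where d: "\<And>js ks. length js = r \<Longrightarrow> past ?N d (js @ ks) \<Longrightarrow> P ks \<Longrightarrow> P js" by blast
      show ?thesis
      proof (rule exI[of _ d], intro allI impI)
        fix zs assume zs: "past ?N d zs"
        then obtain js ks where "zs = js @ ks" "length js = r" using split unfolding past_def by blast
        then show "sat M (env (xs @ i # zs) ?o) (b \<^bold>\<longrightarrow> a)" using P(2) d zs by blast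
      qed
    qed
    from lex_stabilises[of ?N n i ?o a b "[]" n i, OF _ this] show ?thesis
      using le \<open>r > 0\<close> by simp
  qed
  obtain zs where zs: "past ?N i zs" using ex_past by blast
  have all: "\<forall>zs'. past ?N i zs' \<longrightarrow> sat M (env (i # zs') ?o) \<chi>"
    if "LA_form \<chi>" "past ?N i zs" "sat M (env (i # zs) ?o) \<chi>" for \<chi> zs
    using indisc[OF that(1,2)] that(3) by blast
  \<comment> \<open>Totality at the single tuple \<open>zs\<close> settles the direction, and
    \<open>all\<close> spreads it to every tuple beyond \<open>i\<close>.\<close>
  have "\<exists>d. \<forall>zs. past ?N d zs \<longrightarrow> sat M (env (i # zs) ?o) (lex_eq 0 n \<phi> \<psi>)"
    using lex_le_total[of "env (i # zs) ?o" 0 n \<phi> \<psi>]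
  proof
    assume "sat M (env (i # zs) ?o) (lex_le 0 n \<phi> \<psi>)"
    then show ?thesis using eventually all[OF LA_lex_le zs] LA \<open>LA_form \<psi>\<close> by blast
  next
    assume "sat M (env (i # zs) ?o) (lex_le 0 n \<psi> \<phi>)"
    then have "\<exists>d. \<forall>zs. past ?N d zs \<longrightarrow> sat M (env (i # zs) ?o) (lex_eq 0 n \<psi> \<phi>)"
      using eventually all[OF LA_lex_le zs] LA \<open>LA_form \<psi>\<close> by blast
    then show ?thesis unfolding sat_lex_eq by blast
  qed
  then obtain d where d: "\<And>zs. past ?N d zs \<Longrightarrow> sat M (env (i # zs) ?o) (lex_eq 0 n \<phi> \<psi>)" by blast
  \<comment> \<open>Equality known only beyond \<open>d\<close> holds at this tuple; as it also lies
    beyond \<open>i\<close>, indiscernibility carries the equality back to all tuples beyond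
    \<open>i\<close>.\<close>
  obtain zs' where zs': "past ?N d zs'" "past ?N i zs'" using ex_past by blast
  have "LA_form (lex_eq 0 n \<phi> \<psi>)"
    using LA \<open>LA_form \<psi>\<close> by (simp add: lex_eq_def LA_lex_le)
  then have eq: "sat M (env (i # zs) ?o) (lex_eq 0 n \<phi> \<psi>)" if "past ?N i zs" for zs
    using all[OF _ zs'(2) d[OF zs'(1)]] that by blast
  have p: "p xs js \<longleftrightarrow> p xs ks" if "length js = r" "length ks = r" "past ?N i (js @ ks)" for js ks
    using lex_eq_imp_eq[OF eq[OF that(3)] xs(1)] xs(2) \<phi>[OF xs(1) that(1)] \<psi>[OF xs(1) that(1,2)] by simp
  \<comment> \<open>\<open>js\<close> and \<open>ks\<close> may interleave, so they need not form a
    consecutive pair; both are compared with a tuple \<open>ls\<close> beyond them.\<close>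
  obtain d where d: "last js \<prec> d" "last ks \<prec> d" using ex_above by blast
  obtain ls where ls: "length ls = r" "inc ls" "d \<prec> hd ls"
    using ex_inc[of "r - 1" d] \<open>r > 0\<close> by auto
  have "past ?N i (zs @ ls)" if "length zs = r" "inc zs" "i \<prec> hd zs" "last zs \<prec> d" for zs
  proof -
    have "zs \<noteq> []" "ls \<noteq> []" using that(1) ls(1) \<open>r > 0\<close> by auto
    then show ?thesis
      using that ls inc_append[of zs ls] lt_trans[of "last zs" d "hd ls"] by (simp add: past_def)
  qed
  then have "p xs js \<longleftrightarrow> p xs ls" "p xs ks \<longleftrightarrow> p xs ls" using p js ks ls(1) d by blast+
  then show ?thesis unfolding p_def by simp
qed

text \<open>Inside the innermost block the stack is \<open>rev xs, rev ks, rev js, i\<close>, whence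
  the offsets \<open>n\<close>, \<open>n + r\<close> and \<open>n + 2 * r\<close>; the rest is
  \<open>diagonal\<close>. Since \<open>r > 0\<close>, the heads in the premise are those of
  \<open>js\<close> and \<open>ks\<close>.\<close>

lemma sat_diagonal_indiscernibility:
  assumes "LA_form \<phi>" "fv \<phi> \<subseteq> {..<n + 1 + r}" "r > 0"
  shows "sat M e (diagonal_indiscernibility n r \<phi>)"
proof -
  let ?o = "\<lambda>_::nat. zeroM M"
  define A where "A = (Var (2 * r) \<^bold>< hd (vars r r) \<^bold>\<and> Var (2 * r) \<^bold>< hd (vars 0 r))"
  define B where "B = (inst \<phi> (vars 0 n @ Var (n + 2 * r) # vars (n + r) r) \<^bold>\<longleftrightarrow>
    inst \<phi> (vars 0 n @ Var (n + 2 * r) # vars n r))"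
  have AB: "sat M (env (rev xs) e') B"
    if e': "e' = env (rev ks) (env (rev js) (case_nat i e))" and i: "inM M i"
      and js: "length js = r" "inc js" and ks: "length ks = r" "inc ks"
      and A: "sat M e' A"
      and xs: "length xs = n" "\<forall>x\<in>set xs. x \<prec> val M (env (rev xs) e') (Var (n + 2 * r))"
    for i js ks xs e'
  proof -
    have ne: "vars m r \<noteq> []" for m using assms(3) length_vars[of m r] by (metis less_irrefl list.size(3))
    have e'_i: "e' (2 * r) = i" by (simp add: e' env_eq js ks)
    have "map (val M e') (vars r r) = js" "map (val M e') (vars 0 r) = ks"
      using map_val_vars(2)[of "rev ks" r js r M "case_nat i e"] js ks
        map_val_vars(1)[of ks r M "env (rev js) (case_nat i e)"] by (simp_all add: e')
    then have "val M e' (hd (vars r r)) = hd js" "val M e' (hd (vars 0 r)) = hd ks"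
      using ne by (metis hd_map)+
    then have hd: "i \<prec> hd js" "i \<prec> hd ks" using A e'_i by (auto simp: A_def)
    have n2r: "val M (env (rev xs) e') (Var (n + 2 * r)) = i"
      using xs(1) e'_i by (simp add: env_eq)
    have "map (val M (env (rev xs) e')) (vars 0 n) = xs"
      "map (val M (env (rev xs) e')) (vars (n + r) r) = js"
      "map (val M (env (rev xs) e')) (vars n r) = ks"
      using map_val_vars(1)[of xs n M e'] map_val_vars(2)[of "rev xs @ rev ks" "n + r" js r M "case_nat i e"]
        map_val_vars(2)[of "rev xs" n ks r M "env (rev js) (case_nat i e)"] xs(1) js ks
      by (simp_all add: e')
    then have "map (val M (env (rev xs) e')) (vars 0 n @ Var (n + 2 * r) # vars (n + r) r) = xs @ i # js"
      "map (val M (env (rev xs) e')) (vars 0 n @ Var (n + 2 * r) # vars n r) = xs @ i # ks"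
      using n2r by simp_all
    then have "sat M (env (rev xs) e') (inst \<phi> (vars 0 n @ Var (n + 2 * r) # vars (n + r) r)) \<longleftrightarrow>
        sat M (env (xs @ i # js) ?o) \<phi>"
      "sat M (env (rev xs) e') (inst \<phi> (vars 0 n @ Var (n + 2 * r) # vars n r)) \<longleftrightarrow>
        sat M (env (xs @ i # ks) ?o) \<phi>"
      using assms(2) sat_inst[of \<phi> _ M "env (rev xs) e'" ?o] by simp_all
    then show ?thesis
      using diagonal[OF assms i js hd(1) ks hd(2) xs(1)] xs(2) unfolding n2r B_def by simp
  qed
  show ?thesis
    unfolding diagonal_indiscernibility_def A_def[symmetric] B_def[symmetric]
      Forall_I_def sat_Forall_inc_I sat_Foralls_below sat.simps(5,6)
  proof (intro allI impI)
    fix i js ks xs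
    let ?e = "env (rev ks) (env (rev js) (case_nat i e))"
    assume "sat M (case_nat i e) (InI (Var 0))" "length js = r" "inc js" "length ks = r" "inc ks"
      "sat M ?e A" "length xs = n" "\<forall>x\<in>set xs. x \<prec> val M (env (rev xs) ?e) (Var (n + 2 * r))"
    then show "sat M (env (rev xs) ?e) B" by (intro AB[OF refl]) simp_all
  qed
qed

end

section \<open>From models back to provability\<close>

text \<open>Derived in the calculus itself, because the completeness theorem takes it as a
  hypothesis. Cancelling successors on both sides ends with a successor equal to zero.\<close>

lemma numerals_distinct: "m < n \<Longrightarrow> PAI \<turnstile> \<^bold>\<not> (numeral_trm n \<^bold>= numeral_trm m)"
proof (induction m arbitrary: n)
  case 0
  then obtain k where "n = Suc k" by (cases n) auto
  moreover have "PAI \<turnstile> Forall (\<^bold>\<not> (Succ (Var 0) \<^bold>= Zero))"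
    by (rule Assm) (simp add: PAI_def PA_basic_def Foralls_def)
  from ForallE[OF this, of "numeral_trm k"] have "PAI \<turnstile> \<^bold>\<not> (Succ (numeral_trm k) \<^bold>= Zero)"
    by (simp add: subst0_def)
  ultimately show ?case by simp
next
  case (Suc m)
  then obtain k where k: "n = Suc k" "m < k" by (cases n) auto
  let ?s = "numeral_trm k" and ?t = "numeral_trm m"
  have "PAI \<turnstile> Forall (Forall (Succ (Var 1) \<^bold>= Succ (Var 0) \<^bold>\<longrightarrow> Var 1 \<^bold>= Var 0))"
    by (rule Assm) (simp add: PAI_def PA_basic_def Foralls_def numeral_2_eq_2)
  from ForallE[OF this, of ?s]
  have "PAI \<turnstile> Forall (Succ (subst_trm (\<lambda>l. Var (Suc l)) ?s) \<^bold>= Succ (Var 0) \<^bold>\<longrightarrow>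
      subst_trm (\<lambda>l. Var (Suc l)) ?s \<^bold>= Var 0)"
    by (simp add: subst0_def)
  from ForallE[OF this, of ?t] have "PAI \<turnstile> Succ ?s \<^bold>= Succ ?t \<^bold>\<longrightarrow> ?s \<^bold>= ?t"
    by (simp add: subst0_def subst_trm_comp)
  then have "insert (Succ ?s \<^bold>= Succ ?t) PAI \<turnstile> ?s \<^bold>= ?t"
    by (rule ImpE[OF derives_mono Assm]) auto
  moreover have "insert (Succ ?s \<^bold>= Succ ?t) PAI \<turnstile> \<^bold>\<not> (?s \<^bold>= ?t)"
    using Suc.IH[OF k(2)] by (rule derives_mono) auto
  ultimately have "insert (Succ ?s \<^bold>= Succ ?t) PAI \<turnstile> Bot" by (meson ImpE)
  then show ?case unfolding k(1) by (auto intro: ImpI)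
qed

lemma PAI_completeness:
  assumes "\<And>(M :: nat model) e. PAI_model M \<Longrightarrow> sat M e \<phi>"
  shows "PAI \<turnstile> \<phi>"
proof (rule completeness)
  show "fv \<gamma> = {}" if "\<gamma> \<in> PAI" for \<gamma>
    using that by (rule closed_PAI)
  show "PAI \<turnstile> \<^bold>\<not> (numeral_trm n \<^bold>= numeral_trm m)" if "m < n" for m n
    using that by (rule numerals_distinct)
  fix M :: "nat model" and e
  assume M: "\<And>\<gamma>. \<gamma> \<in> PAI \<Longrightarrow> sat M e \<gamma>"
  \<comment> \<open>The axioms are closed, so truth at the one assignment \<open>e\<close> gives
    truth at all assignments, as \<open>PAI_model\<close> demands.\<close>
  have "sat M e' \<gamma>" if "\<gamma> \<in> PAI" for e' \<gamma>
    using M[OF that] sat_cong[of \<gamma> e e' M] closed_PAI[OF that] by simp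
  then show "sat M e \<phi>" by (intro assms PAI_model.intro)
qed

theorem theorem3p5:
  "(\<forall>n \<phi>. LA_form \<phi> \<and> fv \<phi> \<subseteq> {..<n + 1} \<longrightarrow>
      PAI \<turnstile> apartness n \<phi>) \<and>
   (\<forall>n r \<phi>. r \<ge> 1 \<and> LA_form \<phi> \<and> fv \<phi> \<subseteq> {..<n + 1 + r} \<longrightarrow>
      PAI \<turnstile> diagonal_indiscernibility n r \<phi>)"
  by (auto intro!: PAI_completeness PAI_model.sat_apartness PAI_model.sat_diagonal_indiscernibility)

end
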